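(* There is an absolute constant $C>0$ such that for every integer $n\ge 2$ and every $\epsilon\in(0,1/4)$ there exists a PRG for spherical caps on $\mathbb{R}^n$ with error at most $\epsilon$ and seed-length at most $C\left(\log n + \log\log(1/\epsilon)\cdot\log(1/\epsilon)\right)$. That is, there exist an integer $r\le C(\log n+\log\log(1/\epsilon)\log(1/\epsilon))$ and a function $G:\{0,1\}^r\to\mathbb{R}^n$ such that for every halfspace $h:\mathbb{R}^n\to\{-1,1\}$, $$\left|\mathbb{E}_{x\sim \mathbb{S}^{n-1}}[h(x)]-\mathbb{E}_{y\sim\{0,1\}^r}[h(G(y))]\right|\le\epsilon .$$
   Context: A halfspace is a function $h:\mathbb{R}^n\to\{-1,1\}$ of the form $h(x)=\mathrm{sign}(\langle w,x\rangle-c)$ with $w\in\mathbb{R}^n$, $c\in\mathbb{R}$, where $\mathrm{sign}(z)=1$ for $z\ge 0$ and $-1$ otherwise; viewed as functions on the unit sphere $\mathbb{S}^{n-1}\subseteq\mathbb{R}^n$ these are called spherical caps. $x\sim\mathbb{S}^{n-1}$ denotes the uniform (rotation-invariant) probability distribution on $\mathbb{S}^{n-1}$, and $y\sim\{0,1\}^r$ the uniform distribution on $\{0,1\}^r$. A PRG with error $\epsilon$ and seed-length $r$ for spherical caps is a function $G:\{0,1\}^r\to\mathbb{R}^n$ satisfying the displayed inequality for all halfspaces $h$. *)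

theory Defs
  imports "HOL-Probability.Probability"
begin

text \<open>The dimension \<open>n\<close> is quantified inside the theorem, after the absolute constant, so it cannot
  be a type. A point of \<open>\<real>\<^sup>n\<close> is a function on \<open>nat\<close> that is extensional on \<open>{..<n}\<close>, i.e. an element
  of \<open>space (Rn n)\<close>, and \<open>Rn n\<close> carries \<open>n\<close>-dimensional Lebesgue measure on the Borel sets.\<close>

abbreviation Rn :: "nat \<Rightarrow> (nat \<Rightarrow> real) measure" where
  "Rn n \<equiv> \<Pi>\<^sub>M i\<in>{..<n}. lborel"

abbreviation Rn_norm :: "nat \<Rightarrow> (nat \<Rightarrow> real) \<Rightarrow> real" where
  "Rn_norm n x \<equiv> L2_set x {..<n}"

definition Rn_inner :: "nat \<Rightarrow> (nat \<Rightarrow> real) \<Rightarrow> (nat \<Rightarrow> real) \<Rightarrow> real" where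
  "Rn_inner n w x = (\<Sum>i<n. w i * x i)"

text \<open>Not \<^const>\<open>sgn\<close>, which vanishes at \<open>0\<close>.\<close>

definition sign :: "real \<Rightarrow> real" where
  "sign z = (if 0 \<le> z then 1 else -1)"

text \<open>The values of \<open>h\<close> outside \<open>space (Rn n)\<close> are irrelevant.\<close>

definition halfspace :: "nat \<Rightarrow> ((nat \<Rightarrow> real) \<Rightarrow> real) \<Rightarrow> bool" where
  "halfspace n h \<longleftrightarrow>
     (\<exists>w\<in>space (Rn n). \<exists>c. \<forall>x\<in>space (Rn n). h x = sign (Rn_inner n w x - c))"

definition Rn_ball :: "nat \<Rightarrow> (nat \<Rightarrow> real) set" where
  "Rn_ball n = {x \<in> space (Rn n). Rn_norm n x \<le> 1}"

definition Rn_sphere :: "nat \<Rightarrow> (nat \<Rightarrow> real) set" where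
  "Rn_sphere n = {x \<in> space (Rn n). Rn_norm n x = 1}"

definition Rn_normalize :: "nat \<Rightarrow> (nat \<Rightarrow> real) \<Rightarrow> (nat \<Rightarrow> real)" where
  "Rn_normalize n x = (\<lambda>i\<in>{..<n}. x i / Rn_norm n x)"

text \<open>The uniform distribution on the unit sphere, as a measure on \<open>\<real>\<^sup>n\<close>: the law of \<open>x / \<parallel>x\<parallel>\<close> for
  \<open>x\<close> uniform in the unit ball. The lemmas below show that for \<open>n > 0\<close> it is a probability measure,
  concentrated on the sphere and invariant under all orthogonal matrices.\<close>

definition uniform_sphere :: "nat \<Rightarrow> (nat \<Rightarrow> real) measure" where
  "uniform_sphere n = distr (uniform_measure (Rn n) (Rn_ball n)) (Rn n) (Rn_normalize n)"

definition seeds :: "nat \<Rightarrow> bool list set" where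
  "seeds r = {y. length y = r}"

definition PRG_for_caps :: "nat \<Rightarrow> real \<Rightarrow> nat \<Rightarrow> (bool list \<Rightarrow> nat \<Rightarrow> real) \<Rightarrow> bool" where
  "PRG_for_caps n \<epsilon> r G \<longleftrightarrow>
     G \<in> seeds r \<rightarrow> space (Rn n) \<and>
     (\<forall>h. halfspace n h \<longrightarrow>
        \<bar>(\<integral>x. h x \<partial>uniform_sphere n)
          - measure_pmf.expectation (pmf_of_set (seeds r)) (\<lambda>y. h (G y))\<bar> \<le> \<epsilon>)"


lemma sets_Rn_ball [measurable]: "Rn_ball n \<in> sets (Rn n)"
  unfolding Rn_ball_def L2_set_def by measurable

lemma measurable_Rn_normalize [measurable]: "Rn_normalize n \<in> Rn n \<rightarrow>\<^sub>M Rn n"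
  unfolding Rn_normalize_def L2_set_def by measurable

lemma sigma_finite_Rn: "sigma_finite_measure (Rn n)"
proof -
  interpret product_sigma_finite "\<lambda>_::nat. lborel :: real measure"
    by standard
  show ?thesis
    by (rule sigma_finite) simp
qed

lemma emeasure_Rn_box:
  fixes a b :: "nat \<Rightarrow> real"
  assumes "\<And>i. i < n \<Longrightarrow> a i \<le> b i"
  shows "emeasure (Rn n) (\<Pi>\<^sub>E i\<in>{..<n}. {a i..b i}) = ennreal (\<Prod>i<n. b i - a i)"
proof -
  interpret product_sigma_finite "\<lambda>_::nat. lborel :: real measure"
    by standard
  have "emeasure (Rn n) (\<Pi>\<^sub>E i\<in>{..<n}. {a i..b i}) = (\<Prod>i<n. emeasure lborel {a i..b i})"
    by (rule emeasure_PiM) auto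
  also have "\<dots> = (\<Prod>i<n. ennreal (b i - a i))"
    using assms by (intro prod.cong) auto
  also have "\<dots> = ennreal (\<Prod>i<n. b i - a i)"
    using assms by (intro prod_ennreal) auto
  finally show ?thesis .
qed

lemma emeasure_Rn_ball_finite: "emeasure (Rn n) (Rn_ball n) \<noteq> \<infinity>"
proof -
  have "Rn_ball n \<subseteq> (\<Pi>\<^sub>E i\<in>{..<n}. {-1..1})"
  proof
    fix x assume x: "x \<in> Rn_ball n"
    have "\<bar>x i\<bar> \<le> 1" if "i < n" for i
    proof -
      have "\<bar>x i\<bar> \<le> L2_set (\<lambda>i. \<bar>x i\<bar>) {..<n}"
        using that by (intro member_le_L2_set) auto
      also have "\<dots> = Rn_norm n x"
        by (simp add: L2_set_def)
      finally show ?thesis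
        using x by (simp add: Rn_ball_def)
    qed
    then show "x \<in> (\<Pi>\<^sub>E i\<in>{..<n}. {-1..1})"
      using x by (auto simp: Rn_ball_def space_PiM PiE_iff abs_le_iff minus_le_iff)
  qed
  then have "emeasure (Rn n) (Rn_ball n) \<le> emeasure (Rn n) (\<Pi>\<^sub>E i\<in>{..<n}. {-1..1})"
    by (intro emeasure_mono) auto
  also have "\<dots> < \<infinity>"
    by (subst emeasure_Rn_box) auto
  finally show ?thesis
    by simp
qed

lemma emeasure_Rn_ball_pos:
  assumes "0 < n"
  shows "emeasure (Rn n) (Rn_ball n) \<noteq> 0"
proof -
  have "(\<Pi>\<^sub>E i\<in>{..<n}. {-1/real n..1/real n}) \<subseteq> Rn_ball n"
  proof
    fix x assume x: "x \<in> (\<Pi>\<^sub>E i\<in>{..<n}. {-1/real n..1/real n})"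
    have "Rn_norm n x \<le> (\<Sum>i<n. \<bar>x i\<bar>)"
      by (rule L2_set_le_sum_abs)
    also have "\<dots> \<le> (\<Sum>i<n. 1 / real n)"
      using x by (intro sum_mono) (force simp: PiE_iff abs_le_iff minus_le_iff)
    also have "\<dots> = 1"
      using assms by simp
    finally show "x \<in> Rn_ball n"
      using x by (auto simp: Rn_ball_def space_PiM PiE_iff)
  qed
  then have "emeasure (Rn n) (\<Pi>\<^sub>E i\<in>{..<n}. {-1/real n..1/real n}) \<le> emeasure (Rn n) (Rn_ball n)"
    by (intro emeasure_mono) auto
  moreover have "emeasure (Rn n) (\<Pi>\<^sub>E i\<in>{..<n}. {-1/real n..1/real n}) > 0"
    using assms by (subst emeasure_Rn_box) (auto simp: field_simps intro!: prod_pos)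
  ultimately show ?thesis
    by auto
qed

lemma prob_space_uniform_sphere:
  assumes "0 < n"
  shows "prob_space (uniform_sphere n)"
proof -
  interpret prob_space "uniform_measure (Rn n) (Rn_ball n)"
    using assms by (intro prob_space_uniform_measure emeasure_Rn_ball_pos emeasure_Rn_ball_finite)
  show ?thesis
    unfolding uniform_sphere_def by (rule prob_space_distr) measurable
qed

lemma AE_uniform_sphere:
  assumes "0 < n"
  shows "AE x in uniform_sphere n. x \<in> Rn_sphere n"
proof -
  have meas: "{x \<in> space (Rn n). x \<in> Rn_sphere n} \<in> sets (Rn n)"
    unfolding Rn_sphere_def L2_set_def by measurable
  have sub: "{x \<in> space (Rn n). Rn_norm n x = 0} \<subseteq> (\<Pi>\<^sub>E i\<in>{..<n}. {0..0})"
    by (auto simp: space_PiM PiE_iff L2_set_eq_0_iff extensional_def fun_eq_iff)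
  have "emeasure (Rn n) {x \<in> space (Rn n). Rn_norm n x = 0} \<le> emeasure (Rn n) (\<Pi>\<^sub>E i\<in>{..<n}. {0..0})"
    by (rule emeasure_mono[OF sub], rule sets_PiM_I_finite) simp_all
  also have "\<dots> = 0"
    using assms by (subst emeasure_Rn_box) auto
  finally have null: "{x \<in> space (Rn n). Rn_norm n x = 0} \<in> null_sets (Rn n)"
    unfolding L2_set_def by (intro null_setsI) auto
  have "AE x in Rn n. Rn_norm n x \<noteq> 0"
    using AE_not_in[OF null] by (rule AE_mp) (auto intro!: AE_I2)
  then have "AE x in Rn n. Rn_normalize n x \<in> Rn_sphere n"
  proof (rule AE_mp, intro AE_I2 impI)
    fix x assume x: "x \<in> space (Rn n)" "Rn_norm n x \<noteq> 0"
    have "Rn_norm n (Rn_normalize n x) = L2_set (\<lambda>i. (1 / Rn_norm n x) * x i) {..<n}"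
      by (rule L2_set_cong) (auto simp: Rn_normalize_def)
    also have "\<dots> = (1 / Rn_norm n x) * Rn_norm n x"
      by (subst L2_set_right_distrib) auto
    finally show "Rn_normalize n x \<in> Rn_sphere n"
      using x by (auto simp: Rn_sphere_def Rn_normalize_def space_PiM)
  qed
  then have "AE x in uniform_measure (Rn n) (Rn_ball n). Rn_normalize n x \<in> Rn_sphere n"
    by (intro AE_uniform_measureI sets_Rn_ball) auto
  then show ?thesis
    unfolding uniform_sphere_def using meas by (subst AE_distr_iff) auto
qed

definition orthogonal_mat :: "nat \<Rightarrow> (nat \<Rightarrow> nat \<Rightarrow> real) \<Rightarrow> bool" where
  "orthogonal_mat n Q \<longleftrightarrow>
     (\<forall>i<n. \<forall>j<n. (\<Sum>k<n. Q i k * Q j k) = (if i = j then 1 else 0)) \<and>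
     (\<forall>i<n. \<forall>j<n. (\<Sum>k<n. Q k i * Q k j) = (if i = j then 1 else 0))"

definition apply_mat :: "nat \<Rightarrow> (nat \<Rightarrow> nat \<Rightarrow> real) \<Rightarrow> (nat \<Rightarrow> real) \<Rightarrow> (nat \<Rightarrow> real)" where
  "apply_mat n Q x = (\<lambda>i\<in>{..<n}. \<Sum>j<n. Q i j * x j)"

lemma measurable_apply_mat [measurable]: "apply_mat n Q \<in> Rn n \<rightarrow>\<^sub>M Rn n"
  unfolding apply_mat_def by measurable

lemma apply_mat_transpose:
  assumes "orthogonal_mat n Q" "x \<in> space (Rn n)"
  shows "apply_mat n (\<lambda>i j. Q j i) (apply_mat n Q x) = x"
proof
  fix i
  show "apply_mat n (\<lambda>i j. Q j i) (apply_mat n Q x) i = x i"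
  proof (cases "i < n")
    case True
    have "(\<Sum>k<n. Q k i * (\<Sum>j<n. Q k j * x j)) = (\<Sum>k<n. \<Sum>j<n. Q k i * Q k j * x j)"
      by (simp add: sum_distrib_left mult.assoc)
    also have "\<dots> = (\<Sum>j<n. \<Sum>k<n. Q k i * Q k j * x j)"
      by (rule sum.swap)
    also have "\<dots> = (\<Sum>j<n. (\<Sum>k<n. Q k i * Q k j) * x j)"
      by (simp add: sum_distrib_right)
    also have "\<dots> = (\<Sum>j<n. (if i = j then x j else 0))"
      using assms(1) True by (intro sum.cong) (auto simp: orthogonal_mat_def)
    also have "\<dots> = x i"
      using True by simp
    finally show ?thesis
      using True by (simp add: apply_mat_def)
  next
    case False
    then show ?thesis
      using assms(2) by (auto simp: apply_mat_def space_PiM PiE_iff extensional_def)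
  qed
qed

lemma orthogonal_mat_transpose: "orthogonal_mat n Q \<Longrightarrow> orthogonal_mat n (\<lambda>i j. Q j i)"
  by (auto simp: orthogonal_mat_def)

lemma Rn_norm_apply_mat:
  assumes "orthogonal_mat n Q"
  shows "Rn_norm n (apply_mat n Q x) = Rn_norm n x"
proof -
  have "(\<Sum>i<n. (apply_mat n Q x i)\<^sup>2) = (\<Sum>i<n. \<Sum>j<n. \<Sum>k<n. Q i j * x j * (Q i k * x k))"
    by (simp add: apply_mat_def power2_eq_square sum_product)
  also have "\<dots> = (\<Sum>j<n. \<Sum>i<n. \<Sum>k<n. Q i j * x j * (Q i k * x k))"
    by (rule sum.swap)
  also have "\<dots> = (\<Sum>j<n. \<Sum>k<n. \<Sum>i<n. Q i j * x j * (Q i k * x k))"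
    by (intro sum.cong refl sum.swap)
  also have "\<dots> = (\<Sum>j<n. \<Sum>k<n. (\<Sum>i<n. Q i j * Q i k) * (x j * x k))"
    by (simp add: sum_distrib_left sum_distrib_right mult_ac)
  also have "\<dots> = (\<Sum>j<n. \<Sum>k<n. if j = k then x j * x k else 0)"
    using assms by (intro sum.cong refl) (auto simp: orthogonal_mat_def)
  also have "\<dots> = (\<Sum>j<n. (x j)\<^sup>2)"
    by (simp add: power2_eq_square)
  finally show ?thesis
    by (simp add: L2_set_def)
qed

lemma distr_Rn_translate:
  "distr (Rn n) (Rn n) (\<lambda>x. \<lambda>i\<in>{..<n}. v i + x i) = Rn n"
proof -
  interpret product_sigma_finite "\<lambda>_::nat. lborel :: real measure"
    by standard
  show ?thesis
  proof (rule PiM_eqI)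
    fix A :: "nat \<Rightarrow> real set" assume A: "\<And>i. i \<in> {..<n} \<Longrightarrow> A i \<in> sets lborel"
    have pre: "(+) (v i) -` A i \<in> sets lborel" if "i \<in> {..<n}" for i
    proof -
      have "(+) (v i) -` A i \<inter> space borel \<in> sets borel"
        using A[OF that] by (intro measurable_sets[of _ borel borel]) auto
      then show ?thesis by simp
    qed
    have "emeasure (distr (Rn n) (Rn n) (\<lambda>x. \<lambda>i\<in>{..<n}. v i + x i)) (Pi\<^sub>E {..<n} A)
        = emeasure (Rn n) ((\<lambda>x. \<lambda>i\<in>{..<n}. v i + x i) -` Pi\<^sub>E {..<n} A \<inter> space (Rn n))"
      using A by (intro emeasure_distr) auto
    also have "(\<lambda>x. \<lambda>i\<in>{..<n}. v i + x i) -` Pi\<^sub>E {..<n} A \<inter> space (Rn n)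
        = (\<Pi>\<^sub>E i\<in>{..<n}. (+) (v i) -` A i)"
      by (auto simp: space_PiM PiE_iff)
    also have "emeasure (Rn n) \<dots> = (\<Prod>i<n. emeasure lborel ((+) (v i) -` A i))"
      using pre by (intro emeasure_PiM) auto
    also have "\<dots> = (\<Prod>i<n. emeasure lborel (A i))"
    proof (intro prod.cong refl)
      fix i assume i: "i \<in> {..<n}"
      have "emeasure lborel (A i) = emeasure (distr lborel borel ((+) (v i))) (A i)"
        by (simp add: lborel_distr_plus)
      also have "\<dots> = emeasure lborel ((+) (v i) -` A i)"
        using A[OF i] by (subst emeasure_distr) auto
      finally show "emeasure lborel ((+) (v i) -` A i) = emeasure lborel (A i)" ..
    qed
    finally show "emeasure (distr (Rn n) (Rn n) (\<lambda>x. \<lambda>i\<in>{..<n}. v i + x i)) (Pi\<^sub>E {..<n} A)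
        = (\<Prod>i<n. emeasure lborel (A i))" .
  qed auto
qed

lemma nn_integral_Rn_translate:
  assumes "f \<in> borel_measurable (Rn n)"
  shows "(\<integral>\<^sup>+x. f (\<lambda>i\<in>{..<n}. v i + x i) \<partial>Rn n) = (\<integral>\<^sup>+x. f x \<partial>Rn n)"
proof -
  have "(\<integral>\<^sup>+x. f x \<partial>Rn n) = (\<integral>\<^sup>+x. f x \<partial>distr (Rn n) (Rn n) (\<lambda>x. \<lambda>i\<in>{..<n}. v i + x i))"
    by (simp only: distr_Rn_translate)
  also have "\<dots> = (\<integral>\<^sup>+x. f (\<lambda>i\<in>{..<n}. v i + x i) \<partial>Rn n)"
    using assms by (intro nn_integral_distr) auto
  finally show ?thesis ..
qed

lemma apply_mat_add:
  "apply_mat n Q (\<lambda>i\<in>{..<n}. u i + x i) = (\<lambda>i\<in>{..<n}. apply_mat n Q u i + apply_mat n Q x i)"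
  by (auto simp: apply_mat_def sum.distrib distrib_left)

text \<open>The image of Lebesgue measure under an orthogonal matrix is translation invariant and gives the
  unit ball the same mass, so it is Lebesgue measure by uniqueness of Haar measure.\<close>

lemma distr_Rn_orthogonal:
  assumes "0 < n" and Q: "orthogonal_mat n Q"
  shows "distr (Rn n) (Rn n) (apply_mat n Q) = Rn n"
proof -
  let ?Q' = "\<lambda>i j. Q j i"
  let ?N = "distr (Rn n) (Rn n) (apply_mat n Q)"
  let ?B = "indicator (Rn_ball n) :: _ \<Rightarrow> ennreal"
  define add where "add v x = (\<lambda>i\<in>{..<n}. v i + x i)" for v x :: "nat \<Rightarrow> real"
  define sub where "sub v x = (\<lambda>i\<in>{..<n}. v i - x i)" for v x :: "nat \<Rightarrow> real"
  have Q': "orthogonal_mat n ?Q'"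
    by (rule orthogonal_mat_transpose[OF Q])
  have madd [measurable]: "(\<lambda>(v, x). add v x) \<in> Rn n \<Otimes>\<^sub>M Rn n \<rightarrow>\<^sub>M Rn n"
    unfolding add_def split_beta by measurable
  have msub [measurable]: "(\<lambda>(v, x). sub v x) \<in> Rn n \<Otimes>\<^sub>M Rn n \<rightarrow>\<^sub>M Rn n"
    unfolding sub_def split_beta by measurable
  have space_add: "add v x \<in> space (Rn n)" and space_sub: "sub v x \<in> space (Rn n)" for v x
    by (auto simp: add_def sub_def space_PiM)
  have m1 [measurable]: "add v \<in> Rn n \<rightarrow>\<^sub>M Rn n" for v
    unfolding add_def by measurable
  have m2 [measurable]: "(\<lambda>x. sub x v) \<in> Rn n \<rightarrow>\<^sub>M Rn n" for v
    unfolding sub_def by measurable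
  have add_commute: "add v x = add x v" for v x
    by (simp add: add_def add.commute)

  have "distr ?N (Rn n) (apply_mat n ?Q') = distr (Rn n) (Rn n) (apply_mat n ?Q' \<circ> apply_mat n Q)"
    by (rule distr_distr) measurable
  also have "\<dots> = distr (Rn n) (Rn n) (\<lambda>x. x)"
    using apply_mat_transpose[OF Q] by (intro distr_cong) auto
  finally have "distr ?N (Rn n) (apply_mat n ?Q') = Rn n"
    by (simp add: distr_id)
  then have sfN: "sigma_finite_measure ?N"
    using sigma_finite_Rn[of n] by (intro sigma_finite_measure_distr[of ?N "Rn n" "apply_mat n ?Q'"]) auto

  interpret N: sigma_finite_measure ?N by (rule sfN)
  interpret M: sigma_finite_measure "Rn n" by (rule sigma_finite_Rn)
  interpret P: pair_sigma_finite ?N "Rn n" ..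

  have transN: "(\<integral>\<^sup>+y. f (add x y) \<partial>?N) = (\<integral>\<^sup>+y. f y \<partial>?N)"
    if [measurable]: "f \<in> borel_measurable (Rn n)" and x: "x \<in> space (Rn n)" for f x
  proof -
    define u where "u = apply_mat n ?Q' x"
    have u: "apply_mat n Q u = x"
      unfolding u_def using apply_mat_transpose[OF Q' x] by simp
    have "(\<integral>\<^sup>+y. f (add x y) \<partial>?N) = (\<integral>\<^sup>+y. f (add x (apply_mat n Q y)) \<partial>Rn n)"
      by (intro nn_integral_distr) measurable
    also have "\<dots> = (\<integral>\<^sup>+y. f (apply_mat n Q (add u y)) \<partial>Rn n)"
      by (simp add: add_def apply_mat_add u)
    also have "\<dots> = (\<integral>\<^sup>+y. f (apply_mat n Q y) \<partial>Rn n)"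
      unfolding add_def by (rule nn_integral_Rn_translate) measurable
    also have "\<dots> = (\<integral>\<^sup>+y. f y \<partial>?N)"
      by (intro nn_integral_distr[symmetric]) measurable
    finally show ?thesis .
  qed

  have ball: "apply_mat n Q -` Rn_ball n \<inter> space (Rn n) = Rn_ball n"
    using Rn_norm_apply_mat[OF Q] measurable_space[OF measurable_apply_mat[of n Q]]
    by (auto simp: Rn_ball_def)
  have NB: "emeasure ?N (Rn_ball n) = emeasure (Rn n) (Rn_ball n)"
    by (subst emeasure_distr) (auto simp: ball)

  show ?thesis
  proof (rule measure_eqI)
    fix E assume "E \<in> sets ?N"
    then have [measurable]: "E \<in> sets (Rn n)"
      by simp
    let ?E = "indicator E :: _ \<Rightarrow> ennreal"
    have "emeasure (Rn n) E * emeasure ?N (Rn_ball n) = (\<integral>\<^sup>+y. emeasure (Rn n) E * ?B y \<partial>?N)"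
      by (subst nn_integral_cmult_indicator) auto
    also have "\<dots> = (\<integral>\<^sup>+y. (\<integral>\<^sup>+x. ?B y * ?E x \<partial>Rn n) \<partial>?N)"
      by (subst nn_integral_cmult) (auto simp: mult.commute)
    also have "\<dots> = (\<integral>\<^sup>+y. (\<integral>\<^sup>+x. ?B y * ?E (add y x) \<partial>Rn n) \<partial>?N)"
      unfolding add_def
      by (intro nn_integral_cong nn_integral_Rn_translate[where f = "\<lambda>x. ?B _ * ?E x", symmetric])
        measurable
    also have "\<dots> = (\<integral>\<^sup>+x. (\<integral>\<^sup>+y. ?B y * ?E (add y x) \<partial>?N) \<partial>Rn n)"
      by (rule P.Fubini'[symmetric]) (use madd in measurable)
    also have "\<dots> = (\<integral>\<^sup>+x. (\<integral>\<^sup>+y. ?B (sub y x) * ?E y \<partial>?N) \<partial>Rn n)"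
    proof (rule nn_integral_cong)
      fix x assume x: "x \<in> space (Rn n)"
      have "(\<integral>\<^sup>+y. ?B y * ?E (add y x) \<partial>?N)
          = (\<integral>\<^sup>+y. (\<lambda>z. ?B (sub z x) * ?E z) (add x y) \<partial>?N)"
      proof (intro nn_integral_cong)
        fix y assume "y \<in> space ?N"
        then have "sub (add x y) x = y"
          by (auto simp: sub_def add_def space_PiM PiE_iff extensional_def fun_eq_iff)
        then show "?B y * ?E (add y x) = ?B (sub (add x y) x) * ?E (add x y)"
          by (simp add: add_commute)
      qed
      also have "\<dots> = (\<integral>\<^sup>+y. ?B (sub y x) * ?E y \<partial>?N)"
        by (rule transN[OF _ x]) measurable
      finally show "(\<integral>\<^sup>+y. ?B y * ?E (add y x) \<partial>?N) = (\<integral>\<^sup>+y. ?B (sub y x) * ?E y \<partial>?N)" .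
    qed
    also have "\<dots> = (\<integral>\<^sup>+y. (\<integral>\<^sup>+x. ?B (sub y x) * ?E y \<partial>Rn n) \<partial>?N)"
      by (rule P.Fubini') (use msub in measurable)
    also have "\<dots> = (\<integral>\<^sup>+y. emeasure (Rn n) (Rn_ball n) * ?E y \<partial>?N)"
    proof (rule nn_integral_cong)
      fix y assume "y \<in> space ?N"
      have "(\<integral>\<^sup>+x. ?B (sub y x) * ?E y \<partial>Rn n) = (\<integral>\<^sup>+x. ?B (add (\<lambda>i. - y i) x) * ?E y \<partial>Rn n)"
      proof (intro nn_integral_cong)
        fix x
        have "Rn_norm n (sub y x) = Rn_norm n (add (\<lambda>i. - y i) x)"
          by (simp add: L2_set_def sub_def add_def power2_commute)
        then show "?B (sub y x) * ?E y = ?B (add (\<lambda>i. - y i) x) * ?E y"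
          using space_add space_sub by (simp add: Rn_ball_def indicator_def)
      qed
      also have "\<dots> = (\<integral>\<^sup>+x. ?B x * ?E y \<partial>Rn n)"
        unfolding add_def by (rule nn_integral_Rn_translate[where f = "\<lambda>x. ?B x * ?E y"]) measurable
      also have "\<dots> = emeasure (Rn n) (Rn_ball n) * ?E y"
        by (subst nn_integral_multc) auto
      finally show "(\<integral>\<^sup>+x. ?B (sub y x) * ?E y \<partial>Rn n) = emeasure (Rn n) (Rn_ball n) * ?E y" .
    qed
    also have "\<dots> = emeasure (Rn n) (Rn_ball n) * emeasure ?N E"
      by (subst nn_integral_cmult_indicator) auto
    finally have "emeasure (Rn n) (Rn_ball n) * emeasure (Rn n) E
        = emeasure (Rn n) (Rn_ball n) * emeasure ?N E"
      by (simp add: NB mult.commute)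
    then show "emeasure ?N E = emeasure (Rn n) E"
      using emeasure_Rn_ball_pos[OF \<open>0 < n\<close>] emeasure_Rn_ball_finite[of n]
      by (simp add: ennreal_mult_cancel_left)
  qed simp
qed

lemma distr_uniform_sphere_orthogonal:
  assumes "0 < n" and Q: "orthogonal_mat n Q"
  shows "distr (uniform_sphere n) (Rn n) (apply_mat n Q) = uniform_sphere n"
proof -
  let ?U = "uniform_measure (Rn n) (Rn_ball n)"
  have U: "distr ?U (Rn n) (apply_mat n Q) = ?U"
  proof (rule measure_eqI)
    fix A assume "A \<in> sets (distr ?U (Rn n) (apply_mat n Q))"
    then have [measurable]: "A \<in> sets (Rn n)"
      by simp
    have pre: "apply_mat n Q -` A \<inter> space (Rn n) \<in> sets (Rn n)"
      by measurable
    have "emeasure (distr ?U (Rn n) (apply_mat n Q)) A = emeasure ?U (apply_mat n Q -` A \<inter> space (Rn n))"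
      by (subst emeasure_distr) auto
    also have "\<dots> = emeasure (Rn n) (Rn_ball n \<inter> (apply_mat n Q -` A \<inter> space (Rn n)))
        / emeasure (Rn n) (Rn_ball n)"
      by (rule emeasure_uniform_measure[OF sets_Rn_ball pre])
    also have "Rn_ball n \<inter> (apply_mat n Q -` A \<inter> space (Rn n))
        = apply_mat n Q -` (Rn_ball n \<inter> A) \<inter> space (Rn n)"
      using Rn_norm_apply_mat[OF Q] measurable_space[OF measurable_apply_mat[of n Q]]
      by (auto simp: Rn_ball_def)
    also have "emeasure (Rn n) \<dots> = emeasure (distr (Rn n) (Rn n) (apply_mat n Q)) (Rn_ball n \<inter> A)"
      by (subst emeasure_distr) auto
    also have "\<dots> = emeasure (Rn n) (Rn_ball n \<inter> A)"
      by (simp only: distr_Rn_orthogonal[OF assms])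
    finally show "emeasure (distr ?U (Rn n) (apply_mat n Q)) A = emeasure ?U A"
      by simp
  qed simp
  have comm: "apply_mat n Q (Rn_normalize n x) = Rn_normalize n (apply_mat n Q x)" for x
    unfolding Rn_normalize_def Rn_norm_apply_mat[OF Q]
    by (auto simp: apply_mat_def sum_divide_distrib)
  have "distr (uniform_sphere n) (Rn n) (apply_mat n Q) = distr ?U (Rn n) (apply_mat n Q \<circ> Rn_normalize n)"
    unfolding uniform_sphere_def by (rule distr_distr) measurable
  also have "apply_mat n Q \<circ> Rn_normalize n = Rn_normalize n \<circ> apply_mat n Q"
    by (auto simp: comm)
  also have "distr ?U (Rn n) \<dots> = distr (distr ?U (Rn n) (apply_mat n Q)) (Rn n) (Rn_normalize n)"
    by (rule distr_distr[symmetric]) measurable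
  finally show ?thesis
    by (simp only: U uniform_sphere_def)
qed

end

theory Submission
  imports Defs
begin

text \<open>A random sample works. Snapping the normalised coefficients of a halfspace to a grid of mesh
  \<open>1/D\<close> sandwiches it between two members of a finite family whose symmetric difference lies in a
  narrow strip \<open>{x. \<bar>\<langle>v, x\<rangle> - d\<bar> \<le> \<eta>}\<close>; by Hoeffding's inequality and a union bound,
  \<open>O(log |family| / \<epsilon>\<^sup>2)\<close> independent points of the sphere estimate all members of the family at once.
  Only the logarithm of the family's size matters, so \<open>D\<close> may be as large as \<open>exp (poly (n, 1/\<epsilon>))\<close>,
  and the crudest anticoncentration bound for strips suffices; it comes from slicing the cone over
  the strip along a coordinate axis. The sample size \<open>2\<^sup>r\<close> is then
  polynomial in \<open>n\<close> and \<open>1/\<epsilon>\<close>, so even \<open>r = O(log n + log (1/\<epsilon>))\<close>.\<close>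

section \<open>Anticoncentration on strips\<close>

lemma sqrt_sum_squares_lipschitz:
  fixes b s t :: real
  shows "\<bar>sqrt (t\<^sup>2 + b\<^sup>2) - sqrt (s\<^sup>2 + b\<^sup>2)\<bar> \<le> \<bar>t - s\<bar>"
proof -
  have "sqrt (t\<^sup>2 + b\<^sup>2) \<le> sqrt (s\<^sup>2 + b\<^sup>2) + \<bar>t - s\<bar>" for s t :: real
    using real_sqrt_sum_squares_triangle_ineq[of s "t - s" b 0] by simp
  from this[of s t] this[of t s] show ?thesis
    by (simp add: abs_le_iff abs_minus_commute)
qed

lemma sqrt_above_tangent:
  fixes b s t :: real
  assumes b: "b > 0" and s: "s\<^sup>2 + b\<^sup>2 \<le> 1" and t: "t\<^sup>2 + b\<^sup>2 \<le> 1"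
  shows "sqrt (s\<^sup>2 + b\<^sup>2) + s / sqrt (s\<^sup>2 + b\<^sup>2) * (t - s) + b\<^sup>2 * (t - s)\<^sup>2 / 2 \<le> sqrt (t\<^sup>2 + b\<^sup>2)"
proof -
  define g h where "g = sqrt (s\<^sup>2 + b\<^sup>2)" and "h = sqrt (t\<^sup>2 + b\<^sup>2)"
  have g2: "g\<^sup>2 = s\<^sup>2 + b\<^sup>2" and h2: "h\<^sup>2 = t\<^sup>2 + b\<^sup>2"
    by (simp_all add: g_def h_def)
  have g: "0 < g" "g \<le> 1" and h: "0 < h" "h \<le> 1"
    using assms by (auto simp: g_def h_def add_nonneg_pos)
  define u where "u = t * s + b\<^sup>2"
  \<comment> \<open>Lagrange's identity for \<open>(s, b)\<close> and \<open>(t, b)\<close>, whose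
    inner product is \<open>u\<close>.\<close>
  have id: "(g * h)\<^sup>2 - u\<^sup>2 = b\<^sup>2 * (t - s)\<^sup>2"
    unfolding power_mult_distrib g2 h2 u_def by algebra
  have "0 \<le> b\<^sup>2 * (t - s)\<^sup>2"
    by simp
  then have "u\<^sup>2 \<le> (g * h)\<^sup>2"
    using id by linarith
  then have "\<bar>u\<bar> \<le> g * h"
    using g h by (simp add: abs_le_square_iff[symmetric])
  moreover have "g * h \<le> 1"
    using g h by (simp add: mult_le_one)
  ultimately have sum: "0 \<le> g * h + u" "g * h + u \<le> 2" and dif: "0 \<le> g * h - u"
    by auto
  have "b\<^sup>2 * (t - s)\<^sup>2 = (g * h - u) * (g * h + u)"
    unfolding id[symmetric] by algebra
  also have "\<dots> \<le> (g * h - u) * 2"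
    using sum dif by (intro mult_left_mono) auto
  finally have A: "b\<^sup>2 * (t - s)\<^sup>2 / 2 \<le> g * h - u"
    by simp
  have "g * (g + s / g * (t - s) + b\<^sup>2 * (t - s)\<^sup>2 / 2) = g\<^sup>2 + s * (t - s) + g * (b\<^sup>2 * (t - s)\<^sup>2 / 2)"
    using g by (simp add: distrib_left power2_eq_square)
  also have "\<dots> \<le> g\<^sup>2 + s * (t - s) + 1 * (b\<^sup>2 * (t - s)\<^sup>2 / 2)"
    using g by (intro add_left_mono mult_right_mono) auto
  also have "\<dots> \<le> g\<^sup>2 + s * (t - s) + (g * h - u)"
    using A by simp
  also have "\<dots> = g * h"
    unfolding g2 u_def by (simp add: algebra_simps power2_eq_square)
  finally show ?thesis
    using g unfolding g_def[symmetric] h_def[symmetric] by simp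
qed

text \<open>Three points of the slice at mutual distance \<open>\<tau>\<close> are impossible: for small \<open>c\<close> the function is
  strictly monotone, and for large \<open>c\<close> its second difference is bounded away from \<open>0\<close>.\<close>

lemma slice_no_three_points:
  fixes a b c \<sigma> \<tau> \<eta> t1 t2 t3 :: real
  defines "f \<equiv> \<lambda>t. a + \<sigma> * t - c * sqrt (t\<^sup>2 + b\<^sup>2)"
  assumes \<sigma>: "\<bar>\<sigma>\<bar> = 1" and \<tau>: "0 < \<tau>" "\<tau> \<le> b" "8 * \<eta> < b\<^sup>2 * \<tau> ^ 3"
    and gaps: "t1 + \<tau> < t2" "t2 + \<tau> < t3"
    and ball: "t1\<^sup>2 + b\<^sup>2 \<le> 1" "t2\<^sup>2 + b\<^sup>2 \<le> 1" "t3\<^sup>2 + b\<^sup>2 \<le> 1"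
    and small: "\<bar>f t1\<bar> \<le> \<eta>" "\<bar>f t2\<bar> \<le> \<eta>" "\<bar>f t3\<bar> \<le> \<eta>"
  shows False
proof -
  define g where "g t = sqrt (t\<^sup>2 + b\<^sup>2)" for t
  have b2: "b\<^sup>2 \<le> 1"
    using ball(1) zero_le_power2[of t1] by linarith
  then have b: "0 < b" "b \<le> 1"
    using \<tau> by (simp_all add: abs_square_le_1)
  have "0 \<le> \<eta>"
    using small(1) by linarith
  define p q where "p = t2 - t1" and "q = t3 - t2"
  have p: "\<tau> < p" and q: "\<tau> < q"
    using gaps by (auto simp: p_def q_def)
  have f1: "f t1 = a + \<sigma> * t1 - c * g t1" and f2: "f t2 = a + \<sigma> * t2 - c * g t2"
    and f3: "f t3 = a + \<sigma> * t3 - c * g t3"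
    by (auto simp: f_def g_def)
  show False
  proof (cases "\<bar>c\<bar> \<le> 1/2")
    case True
    \<comment> \<open>The linear term has slope of modulus 1 and the root is 1-Lipschitz, so for
      such \<open>c\<close> the values of \<open>f\<close> at \<open>t1\<close> and
      \<open>t2\<close> differ by at least \<open>p / 2\<close>.\<close>
    have "\<bar>c * (g t2 - g t1)\<bar> \<le> 1/2 * p"
      unfolding abs_mult using True sqrt_sum_squares_lipschitz[of t2 b t1] gaps \<tau>
      by (intro mult_mono) (auto simp: g_def p_def)
    moreover have "\<bar>\<sigma> * p\<bar> = p"
      using \<sigma> p \<tau> by (simp add: abs_mult)
    moreover have "\<sigma> * p = (f t2 - f t1) + c * (g t2 - g t1)"
      by (simp add: f1 f2 p_def algebra_simps)
    ultimately have "p \<le> 2 * \<eta> + 1/2 * p"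
      using small by linarith
    then have "\<tau> < 4 * \<eta>"
      using p by linarith
    moreover have "b\<^sup>2 * \<tau> ^ 3 \<le> 1 * \<tau>"
      using b b2 \<tau> power_decreasing[of 1 3 \<tau>] by (intro mult_mono) auto
    ultimately show False
      using \<tau> \<open>0 \<le> \<eta>\<close> by linarith
  next
    case False
    let ?d = "t2 / g t2"
    have "t1 - t2 = - p" "t3 - t2 = q"
      by (simp_all add: p_def q_def)
    then have 1: "g t2 - ?d * p + b\<^sup>2 * p\<^sup>2 / 2 \<le> g t1"
      using sqrt_above_tangent[of b t2 t1] b ball by (simp add: g_def)
    have 3: "g t2 + ?d * q + b\<^sup>2 * q\<^sup>2 / 2 \<le> g t3"
      using sqrt_above_tangent[of b t2 t3] b ball
      by (simp add: g_def q_def algebra_simps)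
    \<comment> \<open>The weights \<open>q\<close>, \<open>- (p + q)\<close>, \<open>p\<close>
      annihilate affine functions at \<open>t1\<close>, \<open>t2\<close>, \<open>t3\<close>. Hence
      the same combination of values of \<open>f\<close> is \<open>- c * D\<close>, which is small,
      while convexity bounds \<open>D\<close> from below.\<close>
    define D where "D = q * g t1 - (p + q) * g t2 + p * g t3"
    have "q * (g t2 - ?d * p + b\<^sup>2 * p\<^sup>2 / 2) + p * (g t2 + ?d * q + b\<^sup>2 * q\<^sup>2 / 2) \<le> q * g t1 + p * g t3"
      using 1 3 p q \<tau> by (intro add_mono mult_left_mono) auto
    then have D: "b\<^sup>2 * (p * q) * (p + q) / 2 \<le> D"
      by (simp add: D_def algebra_simps power2_eq_square add_divide_distrib)
    have "\<tau>\<^sup>2 \<le> p * q"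
      unfolding power2_eq_square using p q \<tau> by (intro mult_mono) auto
    have "b\<^sup>2 * \<tau>\<^sup>2 * (p + q) / 2 \<le> b\<^sup>2 * (p * q) * (p + q) / 2"
      using p q \<tau> \<open>\<tau>\<^sup>2 \<le> p * q\<close> by (intro divide_right_mono mult_right_mono mult_left_mono) auto
    with D have D: "b\<^sup>2 * \<tau>\<^sup>2 * (p + q) / 2 \<le> D"
      by linarith
    have "c * D = - (q * f t1 - (p + q) * f t2 + p * f t3)"
      by (simp add: f1 f2 f3 D_def p_def q_def algebra_simps)
    also have "\<bar>\<dots>\<bar> \<le> q * \<eta> + (p + q) * \<eta> + p * \<eta>"
    proof -
      have "\<bar>q * f t1\<bar> \<le> q * \<eta>" "\<bar>(p + q) * f t2\<bar> \<le> (p + q) * \<eta>" "\<bar>p * f t3\<bar> \<le> p * \<eta>"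
        using small p q \<tau> by (auto simp: abs_mult intro!: mult_left_mono)
      then show ?thesis
        by linarith
    qed
    finally have cD: "\<bar>c * D\<bar> \<le> 2 * \<eta> * (p + q)"
      by (simp add: algebra_simps)
    have "0 \<le> D"
      using D p q \<tau> by (intro order_trans[OF _ D]) auto
    have "1/2 * D \<le> \<bar>c\<bar> * D"
      using False \<open>0 \<le> D\<close> by (intro mult_right_mono) auto
    also have "\<dots> = \<bar>c * D\<bar>"
      using \<open>0 \<le> D\<close> by (simp add: abs_mult)
    finally have "D \<le> 4 * \<eta> * (p + q)"
      using cD by linarith
    with D have "b\<^sup>2 * \<tau>\<^sup>2 * (p + q) \<le> 8 * \<eta> * (p + q)"
      by linarith
    then have "b\<^sup>2 * \<tau>\<^sup>2 \<le> 8 * \<eta>"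
      using p q \<tau> by (simp add: mult_le_cancel_right)
    moreover have "b\<^sup>2 * \<tau> ^ 3 \<le> b\<^sup>2 * \<tau>\<^sup>2"
      using b \<tau> by (intro mult_left_mono power_decreasing) auto
    ultimately show False
      using \<tau> by linarith
  qed
qed

text \<open>A point of \<open>T\<close> further than \<open>\<tau>\<close> from both
  \<open>Inf T\<close> and \<open>Sup T\<close> would be the middle one of three excluded points, so
  two intervals of length \<open>\<tau>\<close> cover \<open>T\<close>. In the application
  \<open>b\<close> is the norm of the coordinates that stay fixed and \<open>a\<close> their share
  of the inner product.\<close>

lemma slice_measure:
  fixes a b c \<sigma> \<tau> \<eta> :: real
  assumes "\<bar>\<sigma>\<bar> = 1" "0 < \<tau>" "\<tau> \<le> b" "8 * \<eta> < b\<^sup>2 * \<tau> ^ 3"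
  defines "T \<equiv> {t. t\<^sup>2 + b\<^sup>2 \<le> 1 \<and> \<bar>a + \<sigma> * t - c * sqrt (t\<^sup>2 + b\<^sup>2)\<bar> \<le> \<eta>}"
  shows "emeasure lborel T \<le> ennreal (2 * \<tau>)"
proof (cases "T = {}")
  case False
  have T: "- 1 \<le> t \<and> t \<le> 1" if "t \<in> T" for t
  proof -
    have "t\<^sup>2 \<le> 1"
      using that zero_le_power2[of b] unfolding T_def mem_Collect_eq by linarith
    then show ?thesis
      by (simp add: abs_square_le_1 abs_le_iff)
  qed
  have bdd: "bdd_below T" "bdd_above T"
    using T by (meson bdd_belowI, meson bdd_aboveI)
  have "T \<subseteq> {Inf T..Inf T + \<tau>} \<union> {Sup T - \<tau>..Sup T}"
  proof (rule ccontr)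
    assume "\<not> ?thesis"
    then obtain t where t: "t \<in> T" "t \<notin> {Inf T..Inf T + \<tau>}" "t \<notin> {Sup T - \<tau>..Sup T}"
      by blast
    then have "Inf T < t - \<tau>" "t + \<tau> < Sup T"
      using cInf_lower[OF t(1) bdd(1)] cSup_upper[OF t(1) bdd(2)] by auto
    then obtain u v where "u \<in> T" "u < t - \<tau>" "v \<in> T" "t + \<tau> < v"
      using cInf_lessD[OF False] less_cSupD[OF False] by blast
    with t(1) show False
      using slice_no_three_points[of \<sigma> \<tau> b \<eta> u t v a c] assms by (auto simp: T_def)
  qed
  then have "emeasure lborel T \<le> emeasure lborel ({Inf T..Inf T + \<tau>} \<union> {Sup T - \<tau>..Sup T})"
    by (intro emeasure_mono) auto
  also have "\<dots> \<le> emeasure lborel {Inf T..Inf T + \<tau>} + emeasure lborel {Sup T - \<tau>..Sup T}"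
    by (intro emeasure_subadditive) auto
  also have "\<dots> = ennreal (2 * \<tau>)"
    using assms(2) by (simp flip: ennreal_plus)
  finally show ?thesis .
qed simp

section \<open>Volumes inside the unit ball, and the passage to the sphere\<close>

lemma abs_le_Rn_norm:
  assumes "i < n"
  shows "\<bar>x i\<bar> \<le> Rn_norm n x"
proof -
  have "\<bar>x i\<bar> \<le> L2_set (\<lambda>i. \<bar>x i\<bar>) {..<n}"
    using assms by (intro member_le_L2_set) auto
  then show ?thesis
    by (simp add: L2_set_def)
qed

lemma borel_measurable_Rn_component: "i < n \<Longrightarrow> (\<lambda>x. x i) \<in> borel_measurable (Rn n)"
  using measurable_component_singleton[of i "{..<n}" "\<lambda>_. lborel :: real measure"] by simp

lemma measurable_Rn_inner [measurable]: "Rn_inner n w \<in> borel_measurable (Rn n)"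
  unfolding Rn_inner_def by measurable

lemma measurable_Rn_norm [measurable]: "Rn_norm n \<in> borel_measurable (Rn n)"
  unfolding L2_set_def by measurable

text \<open>The cube of half-side \<open>1 / n\<close> fits into the ball, because the sum of the
  moduli dominates the norm. The explicit bound becomes the denominator when volumes are turned into
  probabilities.\<close>

lemma emeasure_Rn_ball_ge:
  assumes "0 < n"
  shows "ennreal ((2 / real n) ^ n) \<le> emeasure (Rn n) (Rn_ball n)"
proof -
  have "(\<Pi>\<^sub>E i\<in>{..<n}. {-1/real n..1/real n}) \<subseteq> Rn_ball n"
  proof
    fix x assume x: "x \<in> (\<Pi>\<^sub>E i\<in>{..<n}. {-1/real n..1/real n})"
    have "Rn_norm n x \<le> (\<Sum>i<n. \<bar>x i\<bar>)"
      by (rule L2_set_le_sum_abs)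
    also have "\<dots> \<le> (\<Sum>i<n. 1 / real n)"
      using x by (intro sum_mono) (force simp: PiE_iff abs_le_iff minus_le_iff)
    also have "\<dots> = 1"
      using assms by simp
    finally show "x \<in> Rn_ball n"
      using x by (auto simp: Rn_ball_def space_PiM PiE_iff)
  qed
  then have "emeasure (Rn n) (\<Pi>\<^sub>E i\<in>{..<n}. {-1/real n..1/real n}) \<le> emeasure (Rn n) (Rn_ball n)"
    by (intro emeasure_mono) auto
  moreover have "emeasure (Rn n) (\<Pi>\<^sub>E i\<in>{..<n}. {-1/real n..1/real n}) = ennreal ((2 / real n) ^ n)"
    using assms by (subst emeasure_Rn_box) auto
  ultimately show ?thesis
    by simp
qed

text \<open>Takes care of the points near the hyperplane \<open>x k = 0\<close>, which the estimate
  for cones leaves out.\<close>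

lemma emeasure_slab:
  assumes "k < n" "0 \<le> \<tau>"
  shows "emeasure (Rn n) {x \<in> Rn_ball n. \<bar>x k\<bar> \<le> \<tau>} \<le> ennreal (2 ^ n * \<tau>)"
proof -
  let ?a = "\<lambda>i. if i = k then \<tau> else 1"
  have "{x \<in> Rn_ball n. \<bar>x k\<bar> \<le> \<tau>} \<subseteq> (\<Pi>\<^sub>E i\<in>{..<n}. {- ?a i..?a i})"
  proof
    fix x assume x: "x \<in> {x \<in> Rn_ball n. \<bar>x k\<bar> \<le> \<tau>}"
    then have "\<bar>x i\<bar> \<le> ?a i" if "i < n" for i
      using abs_le_Rn_norm[OF that, of x] by (auto simp: Rn_ball_def)
    then have "- ?a i \<le> x i" "x i \<le> ?a i" if "i < n" for i
      using that by (simp_all only: abs_le_iff) (meson minus_le_iff)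
    then show "x \<in> (\<Pi>\<^sub>E i\<in>{..<n}. {- ?a i..?a i})"
      using x by (simp add: Rn_ball_def space_PiM PiE_iff)
  qed
  then have "emeasure (Rn n) {x \<in> Rn_ball n. \<bar>x k\<bar> \<le> \<tau>} \<le> emeasure (Rn n) (\<Pi>\<^sub>E i\<in>{..<n}. {- ?a i..?a i})"
    by (intro emeasure_mono sets_PiM_I_finite) simp_all
  also have "\<dots> = ennreal (\<Prod>i<n. ?a i - - ?a i)"
    using assms by (intro emeasure_Rn_box) auto
  also have "(\<Prod>i<n. ?a i - - ?a i) = (\<Prod>i<n. 2 * ?a i)"
    by simp
  also have "\<dots> = 2 ^ n * \<tau>"
    using assms by (subst prod.distrib) simp
  finally show ?thesis .
qed

text \<open>The bound \<open>\<tau> \<le> \<bar>x k\<bar>\<close> keeps the slices in direction \<open>j\<close> away from the line through the origin,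
  where \<open>\<lambda>t. sqrt (t\<^sup>2 + b\<^sup>2)\<close> loses its curvature.\<close>

lemma emeasure_cone:
  fixes c :: real
  assumes j: "j < n" and k: "k < n" "k \<noteq> j" and w: "\<bar>w j\<bar> = 1"
    and \<tau>: "0 < \<tau>" and \<eta>: "8 * \<eta> < \<tau> ^ 5"
  defines "T \<equiv> {x \<in> Rn_ball n. \<tau> \<le> \<bar>x k\<bar> \<and> \<bar>Rn_inner n w x - c * Rn_norm n x\<bar> \<le> \<eta>}"
  shows "emeasure (Rn n) T \<le> ennreal (2 ^ n * \<tau>)"
proof -
  interpret product_sigma_finite "\<lambda>_::nat. lborel :: real measure"
    by standard
  let ?I = "{..<n} - {j}"
  have ins: "insert j ?I = {..<n}"
    using j by auto
  have [measurable]: "(\<lambda>x. x k) \<in> borel_measurable (Rn n)"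
    using k by (intro borel_measurable_Rn_component)
  have "T = Rn_ball n \<inter> {x \<in> space (Rn n). \<tau> \<le> \<bar>x k\<bar> \<and> \<bar>Rn_inner n w x - c * Rn_norm n x\<bar> \<le> \<eta>}"
    by (auto simp: T_def Rn_ball_def)
  then have T_meas [measurable]: "T \<in> sets (Rn n)"
    by simp
  \<comment> \<open>Slices over base points outside this cube are empty, so the outer integral runs
    over a set of volume \<open>2 ^ (n - 1)\<close> only.\<close>
  define cube :: "(nat \<Rightarrow> real) set" where "cube = (\<Pi>\<^sub>E i\<in>?I. {-1..1})"
  have cube_meas [measurable]: "cube \<in> sets (\<Pi>\<^sub>M i\<in>?I. lborel)"
    unfolding cube_def by (intro sets_PiM_I_finite) auto
  have slice: "(\<integral>\<^sup>+y. indicator T (x(j := y)) \<partial>lborel) \<le> ennreal (2 * \<tau>) * indicator cube x"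
    if x: "x \<in> space (\<Pi>\<^sub>M i\<in>?I. lborel)" for x
  proof -
    define b a where "b = L2_set x ?I" and "a = (\<Sum>i\<in>?I. w i * x i)"
    have norm: "Rn_norm n (x(j := y)) = sqrt (y\<^sup>2 + b\<^sup>2)" for y
    proof -
      have "(\<Sum>i<n. ((x(j := y)) i)\<^sup>2) = y\<^sup>2 + (\<Sum>i\<in>?I. (x i)\<^sup>2)"
        using j by (subst sum.remove[of _ j]) auto
      then show ?thesis
        by (simp add: L2_set_def b_def sum_nonneg)
    qed
    have inner: "Rn_inner n w (x(j := y)) = a + w j * y" for y
      unfolding Rn_inner_def using j by (subst sum.remove[of _ j]) (auto simp: a_def)
    have b_ge: "\<bar>x i\<bar> \<le> b" if "i \<in> ?I" for i
    proof -
      have "\<bar>x i\<bar> \<le> L2_set (\<lambda>i. \<bar>x i\<bar>) ?I"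
        using that by (intro member_le_L2_set) auto
      then show ?thesis
        by (simp add: L2_set_def b_def)
    qed
    have "0 \<le> b"
      by (simp add: b_def)
    show ?thesis
    proof (cases "x \<in> cube \<and> \<tau> \<le> b")
      case True
      let ?S = "{t. t\<^sup>2 + b\<^sup>2 \<le> 1 \<and> \<bar>a + w j * t - c * sqrt (t\<^sup>2 + b\<^sup>2)\<bar> \<le> \<eta>}"
      \<comment> \<open>The fifth power in the hypothesis on \<open>\<eta>\<close> serves this step:
        \<open>\<tau> \<le> b\<close> turns it into the condition on a slice, uniformly in
        \<open>b\<close>.\<close>
      have "\<tau> ^ 5 = \<tau>\<^sup>2 * \<tau> ^ 3"
        by (simp flip: power_add)
      also have "\<dots> \<le> b\<^sup>2 * \<tau> ^ 3"
        using True \<tau> by (intro mult_right_mono power_mono) auto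
      finally have "emeasure lborel ?S \<le> ennreal (2 * \<tau>)"
        using \<tau> \<eta> w True by (intro slice_measure) auto
      moreover have "(\<integral>\<^sup>+y. indicator T (x(j := y)) \<partial>lborel) \<le> (\<integral>\<^sup>+y. indicator ?S y \<partial>lborel)"
        by (intro nn_integral_mono) (auto simp: T_def Rn_ball_def norm inner indicator_def)
      moreover have "?S \<in> sets lborel"
        by measurable
      ultimately show ?thesis
        using True by simp
    next
      case False
      have "x(j := y) \<notin> T" for y
      proof
        assume T: "x(j := y) \<in> T"
        have "y\<^sup>2 + b\<^sup>2 \<le> 1"
          using T by (auto simp: T_def Rn_ball_def norm)
        then have "b\<^sup>2 \<le> 1"
          using zero_le_power2[of y] by linarith
        then have "b \<le> 1"
          using \<open>0 \<le> b\<close> by (simp add: abs_square_le_1)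
        then have "x i \<in> {-1..1}" if "i \<in> ?I" for i
          using b_ge[OF that] by (auto simp: abs_le_iff)
        then have "x \<in> cube"
          using x by (auto simp: cube_def space_PiM PiE_iff)
        moreover have "\<tau> \<le> b"
          using T k b_ge[of k] by (auto simp: T_def)
        ultimately show False
          using False by blast
      qed
      then show ?thesis
        by simp
    qed
  qed
  have "emeasure (Rn n) T = (\<integral>\<^sup>+x. indicator T x \<partial>(\<Pi>\<^sub>M i\<in>insert j ?I. lborel))"
    unfolding ins by simp
  also have "\<dots> = (\<integral>\<^sup>+x. (\<integral>\<^sup>+y. indicator T (x(j := y)) \<partial>lborel) \<partial>(\<Pi>\<^sub>M i\<in>?I. lborel))"
  proof (rule product_nn_integral_insert)
    show "indicator T \<in> borel_measurable (\<Pi>\<^sub>M i\<in>insert j ?I. lborel)"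
      unfolding ins by measurable
  qed auto
  also have "\<dots> \<le> (\<integral>\<^sup>+x. ennreal (2 * \<tau>) * indicator cube x \<partial>(\<Pi>\<^sub>M i\<in>?I. lborel))"
    by (intro nn_integral_mono slice)
  also have "\<dots> = ennreal (2 * \<tau>) * emeasure (\<Pi>\<^sub>M i\<in>?I. lborel) cube"
    by (rule nn_integral_cmult_indicator) measurable
  also have "emeasure (\<Pi>\<^sub>M i\<in>?I. lborel) cube = (\<Prod>i\<in>?I. emeasure lborel {-1..1::real})"
    unfolding cube_def by (rule emeasure_PiM) auto
  also have "\<dots> = ennreal (2 ^ (n - 1))"
    using j by (simp add: ennreal_power[symmetric])
  also have "ennreal (2 * \<tau>) * \<dots> = ennreal (2 ^ n * \<tau>)"
    using \<tau> j by (cases n) (auto simp: ennreal_mult[symmetric] mult_ac)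
  finally show ?thesis .
qed

text \<open>The preimage of the strip under normalisation, cut with the ball, is covered by a slab
  \<open>A\<close> and a truncated cone \<open>B\<close>, each of volume at most
  \<open>2 ^ n * \<tau>\<close>. Dividing by the lower bound \<open>(2 / n) ^ n\<close> for the ball
  leaves \<open>n ^ n\<close>. The bound \<open>2 \<le> n\<close> supplies a coordinate
  \<open>k\<close> other than \<open>j\<close>.\<close>

lemma strip_measure:
  assumes j: "j < n" and n: "2 \<le> n" and w: "\<bar>w j\<bar> = 1"
    and \<tau>: "0 < \<tau>" and \<eta>: "8 * \<eta> < \<tau> ^ 5"
  shows "measure (uniform_sphere n) {x \<in> space (Rn n). \<bar>Rn_inner n w x - c\<bar> \<le> \<eta>} \<le> 2 * real n ^ n * \<tau>"
proof (cases "0 \<le> \<eta>")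
  case True
  let ?S = "{x \<in> space (Rn n). \<bar>Rn_inner n w x - c\<bar> \<le> \<eta>}" and ?N = "Rn_normalize n"
  let ?pre = "?N -` ?S \<inter> space (Rn n)"
  obtain k where k: "k < n" "k \<noteq> j"
    using n that[of "if j = 0 then 1 else 0"] by (auto split: if_splits)
  define A B where "A = {x \<in> Rn_ball n. \<bar>x k\<bar> \<le> \<tau>}"
    and "B = {x \<in> Rn_ball n. \<tau> \<le> \<bar>x k\<bar> \<and> \<bar>Rn_inner n w x - c * Rn_norm n x\<bar> \<le> \<eta>}"
  have [measurable]: "(\<lambda>x. x k) \<in> borel_measurable (Rn n)"
    using k by (intro borel_measurable_Rn_component)
  have "A = Rn_ball n \<inter> {x \<in> space (Rn n). \<bar>x k\<bar> \<le> \<tau>}"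
    and "B = Rn_ball n \<inter> {x \<in> space (Rn n). \<tau> \<le> \<bar>x k\<bar> \<and> \<bar>Rn_inner n w x - c * Rn_norm n x\<bar> \<le> \<eta>}"
    by (auto simp: A_def B_def Rn_ball_def)
  then have [measurable]: "A \<in> sets (Rn n)" "B \<in> sets (Rn n)"
    by simp_all
  have S: "?S \<in> sets (Rn n)"
    by measurable
  then have pre: "?pre \<in> sets (Rn n)"
    by measurable
  have "Rn_ball n \<inter> ?pre \<subseteq> A \<union> B"
  proof
    fix x assume x: "x \<in> Rn_ball n \<inter> ?pre"
    then have small: "\<bar>Rn_inner n w (?N x) - c\<bar> \<le> \<eta>" and le1: "Rn_norm n x \<le> 1"
      by (auto simp: Rn_ball_def)
    \<comment> \<open>The inequality at the normalised point is multiplied by the norm, which is at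
      most 1. At the origin normalisation divides by 0, but both terms vanish there.\<close>
    have "\<bar>Rn_inner n w x - c * Rn_norm n x\<bar> \<le> \<eta>"
    proof (cases "Rn_norm n x = 0")
      case True
      then have "\<forall>i<n. x i = 0"
        by (simp add: L2_set_eq_0_iff)
      then show ?thesis
        using \<open>0 \<le> \<eta>\<close> True by (simp add: Rn_inner_def)
    next
      case False
      have "Rn_norm n x * Rn_inner n w (?N x) = Rn_inner n w x"
        using False by (simp add: Rn_inner_def Rn_normalize_def sum_distrib_left)
      then have "Rn_inner n w x - c * Rn_norm n x = Rn_norm n x * (Rn_inner n w (?N x) - c)"
        by (simp add: algebra_simps)
      also have "\<bar>\<dots>\<bar> \<le> 1 * \<eta>"
        unfolding abs_mult using le1 small by (intro mult_mono) auto
      finally show ?thesis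
        by simp
    qed
    then show "x \<in> A \<union> B"
      using x by (auto simp: A_def B_def)
  qed
  then have "emeasure (Rn n) (Rn_ball n \<inter> ?pre) \<le> emeasure (Rn n) (A \<union> B)"
    by (intro emeasure_mono) auto
  also have "\<dots> \<le> emeasure (Rn n) A + emeasure (Rn n) B"
    by (intro emeasure_subadditive) auto
  also have "\<dots> \<le> ennreal (2 ^ n * \<tau>) + ennreal (2 ^ n * \<tau>)"
    unfolding A_def B_def using \<tau> \<eta> k j w
    by (intro add_mono emeasure_slab emeasure_cone[where j = j]) auto
  also have "\<dots> = ennreal (2 * 2 ^ n * \<tau>)"
    using \<tau> by (simp flip: ennreal_plus)
  finally have num: "emeasure (Rn n) (Rn_ball n \<inter> ?pre) \<le> ennreal (2 * 2 ^ n * \<tau>)" .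
  define V where "V = measure (Rn n) (Rn_ball n)"
  have V: "emeasure (Rn n) (Rn_ball n) = ennreal V"
    unfolding V_def by (rule emeasure_eq_ennreal_measure) (use emeasure_Rn_ball_finite[of n] in simp)
  have "0 \<le> V"
    by (simp add: V_def)
  then have V_ge: "(2 / real n) ^ n \<le> V"
    using emeasure_Rn_ball_ge[of n, unfolded V] n by simp
  have "0 < (2 / real n) ^ n"
    using n by simp
  with V_ge have "0 < V"
    by linarith
  have "emeasure (uniform_sphere n) ?S = emeasure (uniform_measure (Rn n) (Rn_ball n)) ?pre"
    unfolding uniform_sphere_def by (subst emeasure_distr) auto
  also have "\<dots> = emeasure (Rn n) (Rn_ball n \<inter> ?pre) / emeasure (Rn n) (Rn_ball n)"
    by (rule emeasure_uniform_measure[OF sets_Rn_ball pre])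
  also have "\<dots> \<le> ennreal (2 * 2 ^ n * \<tau>) / ennreal V"
    unfolding V by (intro divide_right_mono_ennreal num)
  also have "\<dots> = ennreal (2 * 2 ^ n * \<tau> / V)"
    using \<tau> \<open>0 < V\<close> by (intro divide_ennreal) auto
  also have "\<dots> \<le> ennreal (2 * 2 ^ n * \<tau> / (2 / real n) ^ n)"
    using \<tau> n V_ge \<open>0 < V\<close> by (intro ennreal_leI divide_left_mono mult_pos_pos) auto
  also have "2 * 2 ^ n * \<tau> / (2 / real n) ^ n = 2 * real n ^ n * \<tau>"
    using n by (simp add: power_divide)
  finally show ?thesis
    using \<tau> by (auto simp: measure_def intro!: enn2real_leI)
next
  case False
  then have empty: "{x \<in> space (Rn n). \<bar>Rn_inner n w x - c\<bar> \<le> \<eta>} = {}"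
    by auto
  show ?thesis
    unfolding empty using \<tau> by simp
qed

section \<open>Simultaneous estimation by sampling\<close>

text \<open>The joint law of the coordinates is the product measure itself, hence the product of its
  marginals, which characterises independence. Hoeffding's inequality needs this.\<close>

lemma (in prob_space) indep_vars_PiM_components:
  assumes "finite I" "I \<noteq> {}"
  shows "prob_space.indep_vars (\<Pi>\<^sub>M i\<in>I. M) (\<lambda>_. M) (\<lambda>i x. x i) I"
proof -
  interpret P: prob_space "\<Pi>\<^sub>M i\<in>I. M"
    by (intro prob_space_PiM prob_space_axioms)
  have "distr (\<Pi>\<^sub>M i\<in>I. M) (\<Pi>\<^sub>M i\<in>I. M) (\<lambda>x. \<lambda>i\<in>I. x i) = distr (\<Pi>\<^sub>M i\<in>I. M) (\<Pi>\<^sub>M i\<in>I. M) (\<lambda>x. x)"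
    by (intro distr_cong) (auto simp: space_PiM PiE_iff extensional_restrict)
  also have "\<dots> = (\<Pi>\<^sub>M i\<in>I. distr (\<Pi>\<^sub>M i\<in>I. M) M (\<lambda>x. x i))"
    unfolding distr_id by (intro PiM_cong refl distr_PiM_component[symmetric] prob_space_axioms)
  finally show ?thesis
    using assms by (subst P.indep_vars_iff_distr_eq_PiM') auto
qed

text \<open>Probabilistic method: each \<open>A\<close> is misjudged with probability at most
  \<open>2 * exp (- 2 * card I * t^2)\<close>, and by assumption these bounds sum to less than 1.
  The almost sure property \<open>Q\<close> is carried along so that the chosen points can be
  required to satisfy it.\<close>

lemma (in prob_space) exists_good_sample:
  fixes I :: "'i set"
  assumes I: "finite I" "I \<noteq> {}"
    and F: "finite F" "F \<subseteq> events"
    and Q: "AE x in M. Q x"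
    and t: "0 < t" "2 * real (card F) * exp (- 2 * real (card I) * t\<^sup>2) < 1"
  shows "\<exists>G. (\<forall>i\<in>I. G i \<in> space M \<and> Q (G i)) \<and>
    (\<forall>A\<in>F. \<bar>real (card {i\<in>I. G i \<in> A}) / real (card I) - prob A\<bar> \<le> t)"
proof -
  let ?P = "\<Pi>\<^sub>M i\<in>I. M"
  interpret P: prob_space ?P
    by (intro prob_space_PiM prob_space_axioms)
  define X where "X A i x = (indicator A (x i) :: real)" for A :: "'a set" and i :: 'i and x
  define bad where "bad A = {x\<in>space ?P. \<bar>(\<Sum>i\<in>I. X A i x) / card I - prob A\<bar> \<ge> t}" for A
  obtain i0 where i0: "i0 \<in> I"
    using I by blast
  have distr_comp: "distr ?P M (\<lambda>x. x i) = M" if "i \<in> I" for i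
    using that by (intro distr_PiM_component prob_space_axioms)
  have X_meas: "X A i \<in> borel_measurable ?P" if "A \<in> F" "i \<in> I" for A i
  proof -
    have [measurable]: "A \<in> events" "(\<lambda>x. x i) \<in> ?P \<rightarrow>\<^sub>M M"
      using that F by auto
    show ?thesis
      unfolding X_def by measurable
  qed
  have bad_meas: "bad A \<in> P.events" if "A \<in> F" for A
    unfolding bad_def using X_meas[OF that] by measurable
  have bad_prob: "P.prob (bad A) \<le> 2 * exp (- 2 * real (card I) * t\<^sup>2)" if A: "A \<in> F" for A
  proof -
    have Am [measurable]: "A \<in> events"
      using A F by auto
    have distr_X: "distr ?P borel (X A i) = distr M borel (indicator A)" if "i \<in> I" for i
    proof -
      have "distr (distr ?P M (\<lambda>x. x i)) borel (indicator A :: _ \<Rightarrow> real) = distr ?P borel (indicator A \<circ> (\<lambda>x. x i))"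
        using that by (intro distr_distr) auto
      moreover have "X A i = indicator A \<circ> (\<lambda>x. x i)"
        by (simp add: X_def fun_eq_iff)
      ultimately show ?thesis
        using that by (simp only: distr_comp)
    qed
    have "P.expectation (X A i0) = (\<integral>x. x \<partial>distr ?P borel (X A i0))"
      using X_meas[OF A i0] by (subst integral_distr) auto
    also have "\<dots> = prob A"
      using i0 by (simp add: distr_X integral_distr)
    finally have exp_X: "P.expectation (X A i0) = prob A" .
    interpret Hoeffding_ineq_iid ?P I "X A" "X A i0" 0 1 "prob A"
    proof unfold_locales
      show "P.indep_vars (\<lambda>_. borel) (X A) I"
        unfolding X_def
        by (rule P.indep_vars_compose2[OF indep_vars_PiM_components[OF I]]) auto
      show "prob A \<equiv> P.expectation (X A i0)"
        by (simp add: exp_X)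
    qed (use I i0 X_meas[OF A i0] in \<open>auto simp: distr_X\<close>, auto simp: X_def)
    show ?thesis
      using Hoeffding_ineq_abs_ge'[of t] t I by (simp add: bad_def)
  qed
  have "P.prob (\<Union>A\<in>F. bad A) \<le> (\<Sum>A\<in>F. P.prob (bad A))"
    using F bad_meas by (intro P.finite_measure_subadditive_finite) auto
  also have "\<dots> \<le> (\<Sum>A\<in>F. 2 * exp (- 2 * real (card I) * t\<^sup>2))"
    by (intro sum_mono bad_prob)
  also have "\<dots> < 1"
    using t by (simp add: mult_ac)
  finally have lt1: "P.prob (\<Union>A\<in>F. bad A) < 1" .
  have B: "(\<Union>A\<in>F. bad A) \<in> P.events"
    using F bad_meas by auto
  have AEQ: "AE x in ?P. \<forall>i\<in>I. Q (x i)"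
    using I(1) by (intro AE_finite_allI AE_PiM_component[of I "\<lambda>_. M"] prob_space_axioms Q)
  have "\<exists>x\<in>space ?P. (\<forall>i\<in>I. Q (x i)) \<and> x \<notin> (\<Union>A\<in>F. bad A)"
  proof (rule ccontr)
    assume neg: "\<not> ?thesis"
    \<comment> \<open>Without a good sample, almost every sample would be bad, contradicting
      \<open>lt1\<close>.\<close>
    have "AE x in ?P. x \<in> (\<Union>A\<in>F. bad A)"
      using AEQ AE_space
    proof eventually_elim
      case (elim x)
      with neg show ?case
        by blast
    qed
    then show False
      using lt1 P.prob_eq_1[OF B] by auto
  qed
  then obtain x where x: "x \<in> space ?P" "\<forall>i\<in>I. Q (x i)" "x \<notin> (\<Union>A\<in>F. bad A)"
    by blast
  have "\<bar>real (card {i\<in>I. x i \<in> A}) / real (card I) - prob A\<bar> \<le> t" if "A \<in> F" for A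
  proof -
    have "(\<Sum>i\<in>I. X A i x) = real (card {i\<in>I. x i \<in> A})"
      using I by (simp add: X_def indicator_def sum.If_cases Int_def)
    then show ?thesis
      using x that by (auto simp: bad_def not_le)
  qed
  then show ?thesis
    using x by (intro exI[of _ x]) (auto simp: space_PiM)
qed

section \<open>A finite family bracketing all caps\<close>

text \<open>The unit ball of the maximum norm, without extensionality: it has to hold points of the
  sphere as well as coefficient vectors such as rounding errors, whose values beyond
  \<open>n\<close> are arbitrary.\<close>

definition unit_cube :: "nat \<Rightarrow> (nat \<Rightarrow> real) set" where
  "unit_cube n = {x. \<forall>i<n. \<bar>x i\<bar> \<le> 1}"

lemma abs_Rn_inner_le:
  assumes "v \<in> unit_cube n" "x \<in> unit_cube n"
  shows "\<bar>Rn_inner n v x\<bar> \<le> real n"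
proof -
  have "\<bar>Rn_inner n v x\<bar> \<le> (\<Sum>i<n. \<bar>v i * x i\<bar>)"
    unfolding Rn_inner_def by (rule sum_abs)
  also have "\<dots> \<le> (\<Sum>i<n. 1)"
    using assms by (intro sum_mono) (auto simp: unit_cube_def abs_mult mult_le_one)
  finally show ?thesis
    by simp
qed

text \<open>Dividing by the largest modulus of a coefficient yields an entry of modulus 1, as the
  strip bound requires. On the cube the inner product is at most \<open>n\<close> in modulus, so
  clamping the threshold to \<open>n + 1\<close> in modulus changes no sign there.\<close>

lemma normalized_halfspace:
  assumes n: "0 < n"
  obtains v d j where "j < n" "\<bar>v j\<bar> = 1" "v \<in> unit_cube n" "\<bar>d\<bar> \<le> real n + 1"
    "\<And>x. x \<in> unit_cube n \<Longrightarrow> 0 \<le> Rn_inner n w x - c \<longleftrightarrow> 0 \<le> Rn_inner n v x - d"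
proof (cases "\<forall>i<n. w i = 0")
  case True
  let ?v = "\<lambda>i::nat. if i = 0 then 1 else 0 :: real"
  \<comment> \<open>For \<open>w = 0\<close> the halfspace is everything or nothing; a threshold
    beyond the range of the inner product on the cube imitates this.\<close>
  let ?d = "if c \<le> 0 then - (real n + 1) else real n + 1"
  show ?thesis
  proof (rule that[of 0 ?v ?d])
    fix x assume x: "x \<in> unit_cube n"
    have "\<bar>Rn_inner n ?v x\<bar> \<le> real n"
      using x by (intro abs_Rn_inner_le) (auto simp: unit_cube_def)
    moreover have "Rn_inner n w x = 0"
      using True by (simp add: Rn_inner_def)
    ultimately show "0 \<le> Rn_inner n w x - c \<longleftrightarrow> 0 \<le> Rn_inner n ?v x - ?d"
      by auto
  qed (use n in \<open>auto simp: unit_cube_def\<close>)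
next
  case False
  define s where "s = Max ((\<lambda>i. \<bar>w i\<bar>) ` {..<n})"
  have s_ge: "\<bar>w i\<bar> \<le> s" if "i < n" for i
    using that by (auto simp: s_def intro!: Max_ge)
  obtain i where "i < n" "w i \<noteq> 0"
    using False by blast
  then have s: "0 < s"
    using s_ge[of i] by linarith
  have "s \<in> (\<lambda>i. \<bar>w i\<bar>) ` {..<n}"
    unfolding s_def using n by (intro Max_in) auto
  then obtain j where j: "j < n" "\<bar>w j\<bar> = s"
    by auto
  let ?v = "\<lambda>i. w i / s" and ?d = "max (- (real n + 1)) (min (real n + 1) (c / s))"
  have v: "?v \<in> unit_cube n"
    using s_ge s by (simp add: unit_cube_def divide_le_eq_1)
  show ?thesis
  proof (rule that[of j ?v ?d])
    fix x assume x: "x \<in> unit_cube n"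
    have "\<bar>Rn_inner n ?v x\<bar> \<le> real n"
      using v x by (rule abs_Rn_inner_le)
    then have "0 \<le> Rn_inner n ?v x - ?d \<longleftrightarrow> 0 \<le> Rn_inner n ?v x - c / s"
      by (auto simp: max_def min_def)
    also have "Rn_inner n ?v x - c / s = (Rn_inner n w x - c) / s"
      by (simp add: Rn_inner_def sum_divide_distrib diff_divide_distrib)
    also have "0 \<le> \<dots> \<longleftrightarrow> 0 \<le> Rn_inner n w x - c"
      using s by (simp add: zero_le_divide_iff)
    finally show "0 \<le> Rn_inner n w x - c \<longleftrightarrow> 0 \<le> Rn_inner n ?v x - ?d"
      by simp
  qed (use j s v in \<open>auto simp: abs_le_iff\<close>)
qed

text \<open>Bounded integer data leave finitely many caps. The offset \<open>s\<close> is separate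
  because one \<open>z\<close> yields both the inner and the outer cap of a bracket.\<close>

definition integral_cap :: "nat \<Rightarrow> (nat \<Rightarrow> int) \<Rightarrow> real \<Rightarrow> (nat \<Rightarrow> real) set" where
  "integral_cap n z s = {x \<in> space (Rn n). s \<le> Rn_inner n (\<lambda>i. of_int (z i)) x - of_int (z n)}"

text \<open>Coordinate \<open>n\<close> of \<open>z\<close> holds the threshold, the others the normal vector; the offsets
  \<open>\<plusminus>(n + 1)\<close> absorb the rounding errors of all \<open>n + 1\<close> coefficients.\<close>

definition cap_net :: "nat \<Rightarrow> nat \<Rightarrow> (nat \<Rightarrow> real) set set" where
  "cap_net n D = (\<lambda>(z, s). integral_cap n z s) `
     ((\<Pi>\<^sub>E i\<in>{..n}. {- int (D * (n + 1))..int (D * (n + 1))}) \<times> {real n + 1, - (real n + 1)})"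

lemma sets_integral_cap [measurable]: "integral_cap n z s \<in> sets (Rn n)"
  unfolding integral_cap_def by measurable

lemma sets_cap_net: "cap_net n D \<subseteq> sets (Rn n)"
  by (auto simp: cap_net_def)

lemma finite_cap_net: "finite (cap_net n D)"
  unfolding cap_net_def by (intro finite_imageI finite_cartesian_product finite_PiE) auto

lemma card_cap_net: "card (cap_net n D) \<le> 2 * (2 * D * (n + 1) + 1) ^ (n + 1)"
proof -
  let ?Z = "\<Pi>\<^sub>E i\<in>{..n}. {- int (D * (n + 1))..int (D * (n + 1))}"
  have "card (cap_net n D) \<le> card (?Z \<times> {real n + 1, - (real n + 1)})"
    unfolding cap_net_def by (intro card_image_le finite_cartesian_product finite_PiE) auto
  also have "\<dots> = card ?Z * 2"
    by (simp add: card_cartesian_product)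
  also have "card ?Z = nat (2 * int (D * (n + 1)) + 1) ^ (n + 1)"
    by (simp add: card_PiE)
  also have "nat (2 * int (D * (n + 1)) + 1) = 2 * D * (n + 1) + 1"
    by linarith
  finally show ?thesis
    by simp
qed

text \<open>Rounding \<open>D * v\<close> and \<open>D * d\<close> down costs at most 1 per
  coefficient, hence at most \<open>n + 1\<close> in the scaled inequality at any point of the cube.
  Offset \<open>n + 1\<close> gives \<open>L\<close> and offset \<open>- (n + 1)\<close> gives
  \<open>U\<close>; between them the rounded form is at most \<open>n + 1\<close> in modulus, so the
  true one, scaled by \<open>D\<close>, is at most \<open>2 * (n + 1)\<close>.\<close>

lemma cap_net_bracket:
  assumes D: "0 < D" and v: "v \<in> unit_cube n" and d: "\<bar>d\<bar> \<le> real n + 1"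
  obtains L U where "L \<in> cap_net n D" "U \<in> cap_net n D" "L \<subseteq> U"
    "\<And>x. x \<in> space (Rn n) \<inter> unit_cube n \<Longrightarrow>
       (x \<in> L \<longrightarrow> 0 \<le> Rn_inner n v x - d) \<and> (0 \<le> Rn_inner n v x - d \<longrightarrow> x \<in> U) \<and>
       (x \<in> U - L \<longrightarrow> \<bar>Rn_inner n v x - d\<bar> \<le> 2 * (real n + 1) / real D)"
proof -
  define z :: "nat \<Rightarrow> int" where "z = (\<lambda>i\<in>{..n}. \<lfloor>real D * (if i = n then d else v i)\<rfloor>)"
  have z_v: "\<bar>of_int (z i) - real D * v i\<bar> \<le> 1" if "i < n" for i
    using that unfolding z_def by (simp add: abs_le_iff) linarith
  have z_d: "\<bar>of_int (z n) - real D * d\<bar> \<le> 1"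
    unfolding z_def by (simp add: abs_le_iff) linarith
  have z_range: "z \<in> (\<Pi>\<^sub>E i\<in>{..n}. {- int (D * (n + 1))..int (D * (n + 1))})"
  proof (rule PiE_I)
    fix i assume i: "i \<in> {..n}"
    define u where "u = (if i = n then d else v i)"
    have "\<bar>u\<bar> \<le> real n + 1"
    proof (cases "i = n")
      case False
      then have "\<bar>v i\<bar> \<le> 1"
        using i v by (simp add: unit_cube_def)
      then show ?thesis
        using False by (simp add: u_def)
    qed (use d in \<open>simp add: u_def\<close>)
    then have "real D * \<bar>u\<bar> \<le> real D * (real n + 1)"
      by (intro mult_left_mono) auto
    then have "\<bar>real D * u\<bar> \<le> real (D * (n + 1))"
      by (simp add: abs_mult algebra_simps)
    then have "- of_int (int (D * (n + 1))) \<le> real D * u" "real D * u \<le> of_int (int (D * (n + 1)))"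
      unfolding of_int_of_nat_eq abs_le_iff by linarith+
    then have "- int (D * (n + 1)) \<le> \<lfloor>real D * u\<rfloor>" "\<lfloor>real D * u\<rfloor> \<le> int (D * (n + 1))"
      unfolding le_floor_iff by (simp, linarith)
    then show "z i \<in> {- int (D * (n + 1))..int (D * (n + 1))}"
      using i by (simp add: z_def u_def)
  qed (simp add: z_def)
  let ?f = "\<lambda>x. Rn_inner n (\<lambda>i. of_int (z i)) x - of_int (z n)"
  have approx: "\<bar>?f x - real D * (Rn_inner n v x - d)\<bar> \<le> real n + 1"
    if "x \<in> unit_cube n" for x
  proof -
    have "Rn_inner n (\<lambda>i. of_int (z i)) x - real D * Rn_inner n v x
        = Rn_inner n (\<lambda>i. of_int (z i) - real D * v i) x"
      by (simp add: Rn_inner_def sum_distrib_left sum_subtractf algebra_simps)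
    also have "\<bar>\<dots>\<bar> \<le> real n"
      using z_v that by (intro abs_Rn_inner_le) (auto simp: unit_cube_def)
    finally have "\<bar>Rn_inner n (\<lambda>i. of_int (z i)) x - real D * Rn_inner n v x\<bar> \<le> real n" .
    then show ?thesis
      using z_d unfolding right_diff_distrib by linarith
  qed
  have net: "integral_cap n z s \<in> cap_net n D" if "s \<in> {real n + 1, - (real n + 1)}" for s
    using z_range that unfolding cap_net_def by (intro image_eqI[of _ _ "(z, s)"]) auto
  show ?thesis
  proof (rule that[OF net net])
    show "integral_cap n z (real n + 1) \<subseteq> integral_cap n z (- (real n + 1))"
      by (auto simp: integral_cap_def)
    fix x assume x: "x \<in> space (Rn n) \<inter> unit_cube n"
    let ?g = "Rn_inner n v x - d"
    have L: "x \<in> integral_cap n z (real n + 1) \<longleftrightarrow> real n + 1 \<le> ?f x"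
      and U: "x \<in> integral_cap n z (- (real n + 1)) \<longleftrightarrow> - (real n + 1) \<le> ?f x"
      using x by (auto simp: integral_cap_def)
    have near: "\<bar>?f x - real D * ?g\<bar> \<le> real n + 1"
      using x by (intro approx) blast
    have 1: "0 \<le> ?g" if "real n + 1 \<le> ?f x"
    proof -
      have "0 \<le> real D * ?g"
        using near that by linarith
      then show ?thesis
        using D by (simp add: zero_le_mult_iff)
    qed
    have 2: "- (real n + 1) \<le> ?f x" if "0 \<le> ?g"
    proof -
      have "0 \<le> real D * ?g"
        using that by simp
      then show ?thesis
        using near by linarith
    qed
    have 3: "\<bar>?g\<bar> \<le> 2 * (real n + 1) / real D" if "- (real n + 1) \<le> ?f x" "\<not> real n + 1 \<le> ?f x"
    proof -
      have "\<bar>?f x\<bar> \<le> real n + 1"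
        using that by (simp only: abs_le_iff) linarith
      then have "\<bar>real D * ?g\<bar> \<le> 2 * (real n + 1)"
        using near abs_triangle_ineq4[of "?f x" "?f x - real D * ?g"] by simp
      then show ?thesis
        using D by (simp add: abs_mult pos_le_divide_eq mult.commute)
    qed
    show "(x \<in> integral_cap n z (real n + 1) \<longrightarrow> 0 \<le> ?g) \<and>
        (0 \<le> ?g \<longrightarrow> x \<in> integral_cap n z (- (real n + 1))) \<and>
        (x \<in> integral_cap n z (- (real n + 1)) - integral_cap n z (real n + 1) \<longrightarrow>
          \<bar>?g\<bar> \<le> 2 * (real n + 1) / real D)"
      unfolding Diff_iff L U using 1 2 3 by blast
  qed simp_all
qed

section \<open>From the net to a generator\<close>

lemma finite_seeds: "finite (seeds r)" and card_seeds: "card (seeds r) = 2 ^ r"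
  using finite_lists_length_eq[of "UNIV :: bool set" r] card_lists_length_eq[of "UNIV :: bool set" r]
  by (simp_all add: seeds_def)

text \<open>On the space \<open>h\<close> is twice an indicator minus 1, so errors of probabilities
  double in the expectation of \<open>h\<close>; hence \<open>\<epsilon> / 2\<close>.\<close>

lemma PRG_for_capsI:
  assumes n: "0 < n" and G: "G \<in> seeds r \<rightarrow> space (Rn n)"
    and close: "\<And>w c. \<bar>measure (uniform_sphere n) {x \<in> space (Rn n). 0 \<le> Rn_inner n w x - c}
      - real (card {y \<in> seeds r. 0 \<le> Rn_inner n w (G y) - c}) / real (card (seeds r))\<bar> \<le> \<epsilon> / 2"
  shows "PRG_for_caps n \<epsilon> r G"
  unfolding PRG_for_caps_def
proof (intro conjI allI impI G)
  fix h assume "halfspace n h"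
  then obtain w c where h: "\<And>x. x \<in> space (Rn n) \<Longrightarrow> h x = sign (Rn_inner n w x - c)"
    by (auto simp: halfspace_def)
  interpret prob_space "uniform_sphere n"
    using n by (rule prob_space_uniform_sphere)
  have sets: "sets (uniform_sphere n) = sets (Rn n)" and space: "space (uniform_sphere n) = space (Rn n)"
    by (simp_all add: uniform_sphere_def)
  let ?H = "{x \<in> space (Rn n). 0 \<le> Rn_inner n w x - c}"
  have H: "?H \<in> events"
    unfolding sets by measurable
  have "(\<integral>x. h x \<partial>uniform_sphere n) = (\<integral>x. 2 * indicator ?H x - 1 \<partial>uniform_sphere n)"
    by (intro Bochner_Integration.integral_cong) (auto simp: space h sign_def)
  also have "\<dots> = 2 * prob ?H - 1"
    using H by (subst Bochner_Integration.integral_diff) (auto simp: prob_space less_top[symmetric])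
  finally have mu: "(\<integral>x. h x \<partial>uniform_sphere n) = 2 * prob ?H - 1" .
  let ?S = "{y \<in> seeds r. 0 \<le> Rn_inner n w (G y) - c}"
  have ne: "seeds r \<noteq> {}" "real (card (seeds r)) \<noteq> 0"
    using card_seeds[of r] by auto
  have "measure_pmf.expectation (pmf_of_set (seeds r)) (\<lambda>y. h (G y))
      = (\<Sum>y\<in>seeds r. h (G y)) / real (card (seeds r))"
    using ne finite_seeds by (intro integral_pmf_of_set)
  also have "(\<Sum>y\<in>seeds r. h (G y)) = (\<Sum>y\<in>seeds r. 2 * (if y \<in> ?S then 1 else 0) - 1)"
    using G by (intro sum.cong) (auto simp: h sign_def Pi_iff)
  also have "\<dots> = 2 * real (card ?S) - real (card (seeds r))"
    by (simp add: sum_subtractf sum_distrib_left[symmetric] sum.If_cases finite_seeds Int_def)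
  also have "\<dots> / real (card (seeds r)) = 2 * (real (card ?S) / real (card (seeds r))) - 1"
    using ne by (simp add: diff_divide_distrib)
  finally show "\<bar>(\<integral>x. h x \<partial>uniform_sphere n)
      - measure_pmf.expectation (pmf_of_set (seeds r)) (\<lambda>y. h (G y))\<bar> \<le> \<epsilon>"
    unfolding mu using close[of w c] by linarith
qed

text \<open>Only the exponent matters later, so every factor is bounded by a power of 2 through
  \<open>m \<le> 2 ^ m\<close>; the factor \<open>n ^ n\<close> contributes the term quadratic in
  \<open>n\<close>.\<close>

lemma cap_net_size:
  assumes n: "2 \<le> n" and q: "1 \<le> q"
  defines "D \<equiv> 17 * (n + 1) * (8 * q * n ^ n) ^ 5"
  shows "2 * card (cap_net n D) \<le> 2 ^ (76 * n ^ 3 * q)"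
proof -
  have pow: "m \<le> 2 ^ m" for m :: nat
    using less_exp[of m] by (rule less_imp_le)
  have n1: "n + 1 \<le> 2 ^ n"
    using less_exp[of n] by linarith
  have "1 \<le> D * (n + 1)"
    using n q unfolding D_def by (simp only: Suc_le_eq One_nat_def) simp
  then have "2 * D * (n + 1) + 1 \<le> 3 * (D * (n + 1))"
    by simp
  \<comment> \<open>Here \<open>51 = 3 * 17\<close> and \<open>2 ^ 15 = 8 ^ 5\<close>; next
    \<open>51 \<le> 2 ^ 6\<close> produces the 21 in the exponent.\<close>
  also have "\<dots> = 51 * (2 ^ 15 * ((n + 1)\<^sup>2 * (q ^ 5 * (n ^ n) ^ 5)))"
    by (simp add: D_def power_mult_distrib power2_eq_square algebra_simps)
  also have "\<dots> \<le> 2 ^ 6 * (2 ^ 15 * ((2 ^ n)\<^sup>2 * ((2 ^ q) ^ 5 * (((2 ^ n) ^ n) ^ 5))))"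
    by (intro mult_le_mono power_mono n1 pow order.refl) simp_all
  also have "\<dots> = 2 ^ (21 + 2 * n + 5 * q + 5 * n * n)"
    by (simp add: power_add power_mult[symmetric] mult_ac)
  finally have k: "2 * D * (n + 1) + 1 \<le> 2 ^ (21 + 2 * n + 5 * q + 5 * n * n)" .
  \<comment> \<open>After this shift both sides of \<open>expo\<close> are polynomials in natural
    numbers, and the right one dominates coefficientwise.\<close>
  obtain a b where ab: "n = 2 + a" "q = 1 + b"
    using n q by (auto simp: le_iff_add)
  have expo: "2 + (21 + 2 * n + 5 * q + 5 * n * n) * (n + 1) \<le> 76 * n ^ 3 * q"
    unfolding ab by (simp add: algebra_simps power3_eq_cube)
  have "2 * card (cap_net n D) \<le> 2 * (2 * (2 * D * (n + 1) + 1) ^ (n + 1))"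
    by (intro mult_le_mono card_cap_net order.refl)
  also have "\<dots> \<le> 2 * (2 * (2 ^ (21 + 2 * n + 5 * q + 5 * n * n)) ^ (n + 1))"
    by (intro mult_le_mono power_mono k order.refl) simp
  also have "\<dots> = 2 ^ (2 + (21 + 2 * n + 5 * q + 5 * n * n) * (n + 1))"
    by (simp only: power_mult power_add) simp
  also have "\<dots> \<le> 2 ^ (76 * n ^ 3 * q)"
    by (intro power_increasing expo) simp
  finally show ?thesis .
qed

text \<open>Error budget: \<open>\<epsilon> / 4\<close> for sampling on the net plus
  \<open>\<epsilon> / 4\<close> for the gap of a bracket give the \<open>\<epsilon> / 2\<close>
  allowed for probabilities. The integer \<open>q\<close> replaces \<open>1 / \<epsilon>\<close> so
  that the mesh parameter is a natural number.\<close>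

lemma exists_PRG_for_caps:
  assumes n: "2 \<le> n" and \<epsilon>: "0 < \<epsilon>" and q: "1 \<le> q" "1 / \<epsilon> \<le> real q"
    and r: "608 * real n ^ 3 * real q ^ 3 < 2 ^ r"
  shows "\<exists>G. PRG_for_caps n \<epsilon> r G"
proof -
  interpret prob_space "uniform_sphere n"
    using n by (intro prob_space_uniform_sphere) simp
  have sets: "sets (uniform_sphere n) = sets (Rn n)" and space: "space (uniform_sphere n) = space (Rn n)"
    by (simp_all add: uniform_sphere_def)
  have "0 < n"
    using n by simp
  \<comment> \<open>Bracketing holds only on the cube, so this is the almost sure property demanded
    of the sample points.\<close>
  have cube: "AE x in uniform_sphere n. x \<in> unit_cube n"
    using AE_uniform_sphere[OF \<open>0 < n\<close>]
  proof eventually_elim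
    case (elim x)
    then show ?case
      using abs_le_Rn_norm[of _ n x] by (simp add: unit_cube_def Rn_sphere_def)
  qed
  \<comment> \<open>Makes the strip bound \<open>2 * n ^ n * \<tau>\<close> equal to
    \<open>1 / (4 * q)\<close>, which is at most \<open>\<epsilon> / 4\<close>.\<close>
  define \<tau> where "\<tau> = 1 / (8 * real q * real n ^ n)"
  \<comment> \<open>Eight times the half-width \<open>2 * (n + 1) / D\<close> is then
    \<open>16 / 17 * \<tau> ^ 5\<close>; the 17 makes this strictly less than
    \<open>\<tau> ^ 5\<close>.\<close>
  define D where "D = 17 * (n + 1) * (8 * q * n ^ n) ^ 5"
  have "0 < \<tau>"
    using n q by (simp add: \<tau>_def)
  have "0 < D"
    using n q by (simp add: D_def)
  have D\<tau>: "2 * (real n + 1) / real D = 2 / 17 * \<tau> ^ 5"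
  proof -
    define K N where "K = 8 * real q * real n ^ n" and "N = real n + 1"
    have "0 < K" "0 < N" "\<tau> = 1 / K"
      using n q by (simp_all add: K_def N_def \<tau>_def)
    moreover have "real D = 17 * N * K ^ 5"
      by (simp add: D_def K_def N_def)
    ultimately show ?thesis
      unfolding N_def[symmetric] by (simp add: power_divide)
  qed
  have q\<epsilon>: "1 / real q \<le> \<epsilon>"
    using q \<epsilon> by (simp add: field_simps)

  have "2 * real (card (cap_net n D)) = real (2 * card (cap_net n D))"
    by simp
  also have "\<dots> \<le> real (2 ^ (76 * n ^ 3 * q))"
    unfolding D_def using cap_net_size[OF n q(1)] by (simp only: of_nat_le_iff)
  also have "\<dots> \<le> exp 1 ^ (76 * n ^ 3 * q)"
    using exp_ge_add_one_self[of 1] by (simp add: power_mono)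
  also have "\<dots> = exp (76 * real n ^ 3 * real q)"
    by (simp add: exp_of_nat_mult[symmetric])
  also have "\<dots> < exp (2 * real (card (seeds r)) * (\<epsilon> / 4)\<^sup>2)"
  proof -
    \<comment> \<open>The Hoeffding exponent is \<open>2 ^ r * \<epsilon>^2 / 8\<close>. The 8 turns
      76 into 608, and replacing \<open>\<epsilon>\<close> by \<open>1 / q\<close> costs two more
      powers of \<open>q\<close>.\<close>
    have "76 * real n ^ 3 * real q = 608 * real n ^ 3 * real q ^ 3 * ((1 / real q)\<^sup>2 / 8)"
      using q by (simp add: power2_eq_square power3_eq_cube)
    also have "\<dots> < 2 ^ r * ((1 / real q)\<^sup>2 / 8)"
      using q by (intro mult_strict_right_mono r) simp
    also have "\<dots> \<le> 2 ^ r * (\<epsilon>\<^sup>2 / 8)"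
      using q\<epsilon> q by (intro mult_left_mono divide_right_mono power_mono) auto
    finally show ?thesis
      by (simp add: card_seeds power_divide mult.commute)
  qed
  finally have size: "2 * real (card (cap_net n D)) * exp (- 2 * real (card (seeds r)) * (\<epsilon> / 4)\<^sup>2) < 1"
    by (simp add: exp_minus field_simps)
  have "seeds r \<noteq> {}"
    using card_seeds[of r] by auto
  then obtain G where G: "\<And>y. y \<in> seeds r \<Longrightarrow> G y \<in> space (Rn n)" "\<And>y. y \<in> seeds r \<Longrightarrow> G y \<in> unit_cube n"
    and sample: "\<And>A. A \<in> cap_net n D \<Longrightarrow>
      \<bar>real (card {y \<in> seeds r. G y \<in> A}) / real (card (seeds r)) - prob A\<bar> \<le> \<epsilon> / 4"
    using exists_good_sample[OF finite_seeds _ finite_cap_net _ cube _ size] sets_cap_net[of n D] \<epsilon>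
    unfolding sets space by auto
  have "PRG_for_caps n \<epsilon> r G"
  proof (rule PRG_for_capsI)
    show "0 < n"
      by fact
    show "G \<in> seeds r \<rightarrow> space (Rn n)"
      using G(1) by blast
    fix w c
    define H where "H = {x \<in> space (Rn n). 0 \<le> Rn_inner n w x - c}"
    have H: "H \<in> events"
      unfolding sets H_def by measurable
    obtain v d j where j: "j < n" "\<bar>v j\<bar> = 1" and v: "v \<in> unit_cube n"
      and d: "\<bar>d\<bar> \<le> real n + 1"
      and vd: "\<And>x. x \<in> unit_cube n \<Longrightarrow>
        0 \<le> Rn_inner n w x - c \<longleftrightarrow> 0 \<le> Rn_inner n v x - d"
      using normalized_halfspace[OF \<open>0 < n\<close>, of w c] by metis
    obtain L U where LU: "L \<in> cap_net n D" "U \<in> cap_net n D" "L \<subseteq> U"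
      and br: "\<And>x. x \<in> space (Rn n) \<inter> unit_cube n \<Longrightarrow>
       (x \<in> L \<longrightarrow> 0 \<le> Rn_inner n v x - d) \<and> (0 \<le> Rn_inner n v x - d \<longrightarrow> x \<in> U) \<and>
       (x \<in> U - L \<longrightarrow> \<bar>Rn_inner n v x - d\<bar> \<le> 2 * (real n + 1) / real D)"
      using cap_net_bracket[OF \<open>0 < D\<close> v d] by metis
    have LU_events: "L \<in> events" "U \<in> events"
      using LU sets_cap_net unfolding sets by auto
    have sandwich: "(x \<in> L \<longrightarrow> x \<in> H) \<and> (x \<in> H \<longrightarrow> x \<in> U)" if "x \<in> space (Rn n)" "x \<in> unit_cube n" for x
      using br[of x] vd[of x] that by (auto simp: H_def)
    define strip where "strip = {x \<in> space (Rn n). \<bar>Rn_inner n v x - d\<bar> \<le> 2 * (real n + 1) / real D}"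
    have strip_events: "strip \<in> events"
      unfolding sets strip_def by measurable
    have narrow: "8 * (2 * (real n + 1) / real D) < \<tau> ^ 5"
      unfolding D\<tau> using \<open>0 < \<tau>\<close> by simp
    have "prob U - prob L = prob (U - L)"
      using LU_events LU by (simp add: finite_measure_Diff)
    also have "\<dots> \<le> prob strip"
    proof (rule finite_measure_mono_AE[OF _ strip_events])
      show "AE x in uniform_sphere n. x \<in> U - L \<longrightarrow> x \<in> strip"
        using cube AE_space
      proof eventually_elim
        case (elim x)
        then show ?case
          using br[of x] by (auto simp: strip_def space)
      qed
    qed
    also have "\<dots> \<le> 2 * real n ^ n * \<tau>"
      unfolding strip_def
      using j(1) n j(2) \<open>0 < \<tau>\<close> narrow by (rule strip_measure)
    also have "\<dots> = (1 / real q) / 4"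
      using n q by (simp add: \<tau>_def)
    also have "\<dots> \<le> \<epsilon> / 4"
      using q\<epsilon> by simp
    finally have gap: "prob U - prob L \<le> \<epsilon> / 4" .
    have "prob L \<le> prob H" "prob H \<le> prob U"
    proof -
      have "AE x in uniform_sphere n. (x \<in> L \<longrightarrow> x \<in> H) \<and> (x \<in> H \<longrightarrow> x \<in> U)"
        using cube AE_space by eventually_elim (auto simp: space sandwich)
      then show "prob L \<le> prob H" "prob H \<le> prob U"
        using H LU_events by (auto intro!: finite_measure_mono_AE)
    qed
    moreover have "card {y \<in> seeds r. G y \<in> L} \<le> card {y \<in> seeds r. G y \<in> H}"
      "card {y \<in> seeds r. G y \<in> H} \<le> card {y \<in> seeds r. G y \<in> U}"
      using sandwich G finite_seeds by (auto intro!: card_mono)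
    then have "real (card {y \<in> seeds r. G y \<in> L}) / real (card (seeds r))
        \<le> real (card {y \<in> seeds r. G y \<in> H}) / real (card (seeds r))"
      "real (card {y \<in> seeds r. G y \<in> H}) / real (card (seeds r))
        \<le> real (card {y \<in> seeds r. G y \<in> U}) / real (card (seeds r))"
      by (auto intro!: divide_right_mono)
    ultimately have "\<bar>prob H - real (card {y \<in> seeds r. G y \<in> H}) / real (card (seeds r))\<bar> \<le> \<epsilon> / 2"
      using sample[OF LU(1)] sample[OF LU(2)] gap by linarith
    moreover have "{y \<in> seeds r. G y \<in> H} = {y \<in> seeds r. 0 \<le> Rn_inner n w (G y) - c}"
      using G by (auto simp: H_def)
    ultimately show "\<bar>prob {x \<in> space (Rn n). 0 \<le> Rn_inner n w x - c}
      - real (card {y \<in> seeds r. 0 \<le> Rn_inner n w (G y) - c}) / real (card (seeds r))\<bar> \<le> \<epsilon> / 2"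
      by (simp add: H_def)
  qed
  then show ?thesis
    by blast
qed

section \<open>Choice of the seed length\<close>

theorem mainTheorem1:
  shows "\<exists>C::real. C > 0 \<and>
    (\<forall>n::nat. \<forall>\<epsilon>::real. n \<ge> 2 \<longrightarrow> 0 < \<epsilon> \<longrightarrow> \<epsilon> < 1/4 \<longrightarrow>
      (\<exists>(r::nat) (G :: bool list \<Rightarrow> nat \<Rightarrow> real).
         real r \<le> C * (log 2 (real n) + log 2 (log 2 (1/\<epsilon>)) * log 2 (1/\<epsilon>)) \<and>
         PRG_for_caps n \<epsilon> r G))"
proof -
  have PRG: "\<exists>r G. real r \<le> 17 * (log 2 (real n) + log 2 (log 2 (1/\<epsilon>)) * log 2 (1/\<epsilon>)) \<and> PRG_for_caps n \<epsilon> r G"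
    if n: "2 \<le> n" and \<epsilon>: "0 < \<epsilon>" "\<epsilon> < 1/4" for n :: nat and \<epsilon> :: real
  proof -
    define q where "q = nat \<lceil>1 / \<epsilon>\<rceil>"
    have inv: "4 < 1 / \<epsilon>"
      using \<epsilon> by (simp add: field_simps)
    then have q: "1 / \<epsilon> \<le> real q" "1 \<le> q" "real q \<le> 2 * (1 / \<epsilon>)"
      unfolding q_def by linarith+
    \<comment> \<open>1024 is a power of 2 above 608, so its logarithm is exactly 10.\<close>
    define r where "r = nat \<lceil>log 2 (1024 * real n ^ 3 * real q ^ 3)\<rceil>"
    have pos: "0 < real n ^ 3 * real q ^ 3"
      using n q by simp
    have "608 * real n ^ 3 * real q ^ 3 < 1024 * real n ^ 3 * real q ^ 3"
      using pos by (simp add: mult.assoc)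
    also have "\<dots> = 2 powr log 2 (1024 * real n ^ 3 * real q ^ 3)"
      using pos by (subst powr_log_cancel) (auto simp: mult.assoc)
    also have "\<dots> \<le> 2 powr real r"
      unfolding r_def by (intro powr_mono) linarith+
    also have "\<dots> = 2 ^ r"
      by (simp add: powr_realpow)
    finally obtain G where G: "PRG_for_caps n \<epsilon> r G"
      using exists_PRG_for_caps[OF n \<epsilon>(1) q(2,1)] by blast
    define E where "E = log 2 (1 / \<epsilon>)"
    have log4: "log 2 4 = (2::real)"
      using log_pow_cancel[of "2::real" 2] by simp
    have "1 \<le> log 2 (real n)"
      using n by simp
    have "log 2 4 \<le> E"
      unfolding E_def using inv \<epsilon> by (subst log_le_cancel_iff) auto
    then have "2 \<le> E"
      by (simp only: log4)
    \<comment> \<open>This is where \<open>\<epsilon> < 1/4\<close> enters: it gives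
      \<open>2 \<le> E\<close>, so the factor \<open>log 2 E\<close> can only enlarge
      \<open>E\<close>.\<close>
    then have "1 \<le> log 2 E"
      by simp
    then have E: "E \<le> log 2 E * E"
      using \<open>2 \<le> E\<close> by simp
    have log1024: "log 2 1024 = (10::real)"
      using log_pow_cancel[of "2::real" 10] by simp
    have "log 2 (real q) \<le> log 2 (2 * (1 / \<epsilon>))"
      using q \<epsilon> by (subst log_le_cancel_iff) auto
    also have "\<dots> = 1 + E"
      using \<epsilon> unfolding E_def by (subst log_mult) auto
    finally have "log 2 (real q) \<le> 1 + E" .
    moreover have "log 2 (1024 * real n ^ 3 * real q ^ 3) = 10 + 3 * log 2 (real n) + 3 * log 2 (real q)"
      using n q by (simp add: log_mult log_nat_power log1024)
    moreover have "0 \<le> log 2 (real q)"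
      using q by simp
    ultimately have "real r \<le> 14 + 3 * log 2 (real n) + 3 * E"
      unfolding r_def using \<open>1 \<le> log 2 (real n)\<close> by linarith
    \<comment> \<open>The additive 14 is absorbed through \<open>1 \<le> log 2 n\<close>, hence
      \<open>17 = 14 + 3\<close>.\<close>
    also have "\<dots> \<le> 17 * (log 2 (real n) + log 2 E * E)"
      unfolding distrib_left using E \<open>2 \<le> E\<close> \<open>1 \<le> log 2 (real n)\<close> by linarith
    finally show ?thesis
      using G unfolding E_def by blast
  qed
  show ?thesis
  proof (intro exI[of _ "17::real"] conjI allI impI)
    fix n :: nat and \<epsilon> :: real
    assume "2 \<le> n" "0 < \<epsilon>" "\<epsilon> < 1/4"
    then show "\<exists>r G. real r \<le> 17 * (log 2 (real n) + log 2 (log 2 (1/\<epsilon>)) * log 2 (1/\<epsilon>)) \<and> PRG_for_caps n \<epsilon> r G"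
      by (rule PRG)
  qed simp
qed

end
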